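(* Let $\nu$ be a finite Borel measure on $(0,1)$ whose absolutely continuous part with respect to Lebesgue measure $\Lambda$ is non-zero. Then for every $q\in[0,1]$ the limit $\lim_{n\to\infty}\beta_n^\nu(q)$ exists and $\beta_\nu(q)=\lim_{n\to\infty}\beta_n^\nu(q)=1-q$. In particular, $\nu$ is $L^q$-regular, and the spectral dimension exists and equals $1/2$, i.e. $\underline s_\nu=\overline s_\nu=1/2$.
   Context: $\Lambda$ is Lebesgue measure. For $n\in\mathbb N$ and $0\le k<2^n$ let $A^n_k:=(k2^{-n},(k+1)2^{-n}]$ and $\mathcal D_{\nu,n}:=\{A^n_k:\nu(A^n_k)>0\}$. For $q\in\mathbb R$ put $\beta^\nu_n(q):=\frac{1}{\log 2^n}\log\sum_{C\in\mathcal D_{\nu,n}}\nu(C)^q$ and $\beta_\nu(q):=\limsup_{n\to\infty}\beta_n^\nu(q)$. For all large $n$ there is a unique $q_n\ge0$ with $\beta_n^\nu(q_n)=q_n$; $\overline q_\nu:=\limsup_{n\to\infty}q_n$. $\nu$ is called $L^q$-regular if (a) there is $\varepsilon>0$ with $\beta_\nu(q)=\liminf_n\beta_n^\nu(q)$ for all $q\in(\overline q_\nu-\varepsilon,\overline q_\nu)$, or (b) $\beta_\nu(\overline q_\nu)=\liminf_n\beta_n^\nu(\overline q_\nu)$ and $\beta_\nu$ is differentiable at $\overline q_\nu$. Spectral dimension. $\nu$ is regarded as a measure on $[0,1]$. $H^1_0(0,1)$ is the space of functions $f:[0,1]\to\mathbb R$ with $f(x)=\int_{[0,x]}g\,d\Lambda$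 for some $g\in L^2_\Lambda([0,1])$ and $f(0)=f(1)=0$; $\nabla_\Lambda f:=g$. $C_\nu([0,1])$ is the set of continuous real functions on $[0,1]$ that are affine linear on every connected component of $[0,1]\setminus\operatorname{supp}\nu$. $\operatorname{dom}(\mathcal E_\nu):=H^1_0(0,1)\cap C_\nu([0,1])$, $\mathcal E_\nu(f,g):=\int_{(0,1)}\nabla_\Lambda f\,\nabla_\Lambda g\,d\Lambda$. A number $\lambda$ is an eigenvalue of $\mathcal E_\nu$ if there is $f\in\operatorname{dom}(\mathcal E_\nu)\setminus\{0\}$ with $\mathcal E_\nu(f,g)=\lambda\int fg\,d\nu$ for all $g\in\operatorname{dom}(\mathcal E_\nu)$. $N_\nu(x)$ is the number of eigenvalues $\le x$ (with multiplicity). $\underline{s}_\nu:=\liminf_{x\to\infty}\frac{\log N_\nu(x)}{\log x}$, $\overline{s}_\nu:=\limsup_{x\to\infty}\frac{\log N_\nu(x)}{\log x}$; if they coincide the common value $s_\nu$ is the spectral dimension. *)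

theory Defs
  imports "HOL-Analysis.Analysis" "HOL-Library.Function_Algebras"
begin

text \<open>
  A measure \<open>\<nu>\<close> on \<open>(0,1)\<close>, which is also to be regarded as a measure on \<open>[0,1]\<close>, is
  represented by a Borel measure on the real line that does not charge the complement of \<open>(0,1)\<close>.
\<close>

definition finite_borel_measure_01 :: "real measure \<Rightarrow> bool" where
  "finite_borel_measure_01 \<nu> \<longleftrightarrow>
     finite_measure \<nu> \<and> sets \<nu> = sets borel \<and> emeasure \<nu> (- {0<..<1}) = 0"

definition mutually_singular :: "'a measure \<Rightarrow> 'a measure \<Rightarrow> bool" where
  "mutually_singular M N \<longleftrightarrow>
     (\<exists>A\<in>sets M. A \<in> sets N \<and> emeasure M A = 0 \<and> emeasure N (space N - A) = 0)"

definition lebesgue_decomposition :: "real measure \<Rightarrow> real measure \<Rightarrow> real measure \<Rightarrow> bool" where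
  "lebesgue_decomposition \<nu> \<nu>a \<nu>s \<longleftrightarrow>
     sets \<nu>a = sets borel \<and> sets \<nu>s = sets borel \<and>
     (\<forall>A\<in>sets borel. emeasure \<nu> A = emeasure \<nu>a A + emeasure \<nu>s A) \<and>
     absolutely_continuous lborel \<nu>a \<and> mutually_singular lborel \<nu>s"


section \<open>Partition functions and the \<open>L\<^sup>q\<close>-spectrum\<close>

definition dyadic_cell :: "nat \<Rightarrow> nat \<Rightarrow> real set" where
  "dyadic_cell n k = {real k / 2 ^ n <.. (real k + 1) / 2 ^ n}"

definition charged_cells :: "real measure \<Rightarrow> nat \<Rightarrow> real set set" where
  "charged_cells \<nu> n = {dyadic_cell n k | k. k < 2 ^ n \<and> measure \<nu> (dyadic_cell n k) > 0}"

definition beta_n :: "real measure \<Rightarrow> nat \<Rightarrow> real \<Rightarrow> real" where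
  "beta_n \<nu> n q = 1 / ln (2 ^ n) * ln (\<Sum>C\<in>charged_cells \<nu> n. measure \<nu> C powr q)"

text \<open>For \<open>q < 0\<close> the upper limit may be infinite, hence the extended reals.\<close>

definition beta :: "real measure \<Rightarrow> real \<Rightarrow> ereal" where
  "beta \<nu> q = limsup (\<lambda>n. ereal (beta_n \<nu> n q))"

definition beta_lower :: "real measure \<Rightarrow> real \<Rightarrow> ereal" where
  "beta_lower \<nu> q = liminf (\<lambda>n. ereal (beta_n \<nu> n q))"

text \<open>
  For \<open>\<nu> \<noteq> 0\<close> the fixed point exists and is unique for all large \<open>n\<close>; the finitely many
  remaining \<open>n\<close> do not matter for \<open>upper_q\<close>.
\<close>

definition fixed_q :: "real measure \<Rightarrow> nat \<Rightarrow> real" where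
  "fixed_q \<nu> n = (THE q. q \<ge> 0 \<and> beta_n \<nu> n q = q)"

definition upper_q :: "real measure \<Rightarrow> ereal" where
  "upper_q \<nu> = limsup (\<lambda>n. ereal (fixed_q \<nu> n))"

text \<open>Finiteness near the point excludes the junk value \<open>real_of_ereal \<infinity> = 0\<close>.\<close>

definition ereal_differentiable_at :: "(real \<Rightarrow> ereal) \<Rightarrow> real \<Rightarrow> bool" where
  "ereal_differentiable_at f x \<longleftrightarrow>
     (\<forall>\<^sub>F y in nhds x. \<bar>f y\<bar> \<noteq> \<infinity>) \<and> (\<lambda>y. real_of_ereal (f y)) differentiable (at x)"

definition Lq_regular :: "real measure \<Rightarrow> bool" where
  "Lq_regular \<nu> \<longleftrightarrow>
     (\<exists>qbar::real. upper_q \<nu> = ereal qbar \<and>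
        ((\<exists>\<epsilon>>0. \<forall>q\<in>{qbar - \<epsilon><..<qbar}. beta \<nu> q = beta_lower \<nu> q) \<or>
         (beta \<nu> qbar = beta_lower \<nu> qbar \<and> ereal_differentiable_at (beta \<nu>) qbar)))"


section \<open>Spectral dimension\<close>

definition supp_measure :: "real measure \<Rightarrow> real set" where
  "supp_measure \<nu> = {x. \<forall>U. open U \<and> x \<in> U \<longrightarrow> emeasure \<nu> U > 0}"

text \<open>
  Functions on \<open>[0,1]\<close> that vanish at both end points are identified with their extensions by
  zero to the real line, so that equality of functions and linear (in)dependence are the usual
  ones for functions on \<open>[0,1]\<close>.
\<close>

definition is_gradient :: "(real \<Rightarrow> real) \<Rightarrow> (real \<Rightarrow> real) \<Rightarrow> bool" where
  "is_gradient f g \<longleftrightarrow>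
     set_borel_measurable lborel {0..1} g \<and>
     set_integrable lborel {0..1} (\<lambda>x. (g x)\<^sup>2) \<and>
     (\<forall>x\<in>{0..1}. f x = (LINT y:{0..x}|lborel. g y))"

definition H10 :: "(real \<Rightarrow> real) set" where
  "H10 = {f. (\<exists>g. is_gradient f g) \<and> f 0 = 0 \<and> f 1 = 0 \<and> (\<forall>x. x \<notin> {0..1} \<longrightarrow> f x = 0)}"

text \<open>The gradient is unique almost everywhere on \<open>[0,1]\<close>.\<close>

definition gradient :: "(real \<Rightarrow> real) \<Rightarrow> real \<Rightarrow> real" where
  "gradient f = (SOME g. is_gradient f g)"

definition C_space :: "real measure \<Rightarrow> (real \<Rightarrow> real) set" where
  "C_space \<nu> = {f. continuous_on {0..1} f \<and>
     (\<forall>I\<in>components ({0..1} - supp_measure \<nu>). \<exists>a b. \<forall>x\<in>I. f x = a * x + b)}"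

definition form_dom :: "real measure \<Rightarrow> (real \<Rightarrow> real) set" where
  "form_dom \<nu> = H10 \<inter> C_space \<nu>"

definition energy_form :: "(real \<Rightarrow> real) \<Rightarrow> (real \<Rightarrow> real) \<Rightarrow> real" where
  "energy_form f g = (LINT x:{0<..<1}|lborel. gradient f x * gradient g x)"

definition eigenspace :: "real measure \<Rightarrow> real \<Rightarrow> (real \<Rightarrow> real) set" where
  "eigenspace \<nu> \<mu> =
     {f \<in> form_dom \<nu>. \<forall>g\<in>form_dom \<nu>. energy_form f g = \<mu> * (LINT x|\<nu>. f x * g x)}"

definition is_eigenvalue :: "real measure \<Rightarrow> real \<Rightarrow> bool" where
  "is_eigenvalue \<nu> \<mu> \<longleftrightarrow> (\<exists>f\<in>eigenspace \<nu> \<mu>. f \<noteq> (\<lambda>x. 0))"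

text \<open>
  The dimension is that of a subspace of the real vector space of functions with pointwise
  operations.  The spectrum of \<open>\<E>\<^sub>\<nu>\<close> is discrete with finite multiplicities, so neither the
  sum over an infinite set nor the dimension of an infinite-dimensional space occurs below.
\<close>

definition multiplicity_ev :: "real measure \<Rightarrow> real \<Rightarrow> nat" where
  "multiplicity_ev \<nu> \<mu> =
     vector_space.dim (\<lambda>(c::real) (f::real \<Rightarrow> real). \<lambda>x. c * f x) (eigenspace \<nu> \<mu>)"

definition eigenvalue_count :: "real measure \<Rightarrow> real \<Rightarrow> nat" where
  "eigenvalue_count \<nu> x = (\<Sum>\<mu> | is_eigenvalue \<nu> \<mu> \<and> \<mu> \<le> x. multiplicity_ev \<nu> \<mu>)"

definition lower_spectral_dim :: "real measure \<Rightarrow> ereal" where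
  "lower_spectral_dim \<nu> =
     Liminf at_top (\<lambda>x::real. ereal (ln (real (eigenvalue_count \<nu> x)) / ln x))"

definition upper_spectral_dim :: "real measure \<Rightarrow> ereal" where
  "upper_spectral_dim \<nu> =
     Limsup at_top (\<lambda>x::real. ereal (ln (real (eigenvalue_count \<nu> x)) / ln x))"

end

theory Submission
  imports Defs "HOL-Complex_Analysis.Great_Picard" "HOL-Real_Asymp.Real_Asymp"
begin

text \<open>
  Truncating the density of the absolutely continuous part at 1 yields a non-zero measure
  \<open>\<rho> \<le> \<nu>\<close> with \<open>\<rho> \<le> \<Lambda>\<close>. A dyadic cell \<open>C\<close> of level \<open>n\<close> with \<open>\<rho>(C) > 0\<close> then satisfies
  \<open>\<nu>(C)\<^sup>q \<ge> \<rho>(C) 2\<^bsup>n(1-q)\<^esup>\<close>, and summation gives the lower bound for the partition function; the upper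
  bound comes from \<open>t\<^sup>q \<le> 2\<^bsup>n(1-q)\<^esup> (2\<^bsup>-n\<^esup> + t)\<close>.

  For the eigenvalue count, a function of \<open>H\<^sup>1\<^sub>0\<close> that vanishes at \<open>K\<close> suitably chosen points satisfies
  \<open>\<integral> f\<^sup>2 d\<nu> \<le> ((1 + \<nu>(\<real>)) / K)\<^sup>2 \<integral> f'\<^sup>2\<close>, so that \<open>N(x) \<le> K\<close> once \<open>K > (1 + \<nu>(\<real>)) \<surd>x\<close>. Conversely, of
  \<open>K\<close> cells of length \<open>1/K\<close> a fixed proportion has \<open>\<nu>\<close>-mass at least a constant over \<open>K\<close>; disjoint
  trapezoids over such cells and the variational principle give \<open>N(const K\<^sup>2) \<ge> const K\<close>. The
  principle is applied on all of \<open>H\<^sup>1\<^sub>0\<close>, without projecting to the form domain, because eigenfunctions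
  for \<open>H\<^sup>1\<^sub>0\<close> are automatically affine on the gaps of the support.
\<close>

section \<open>The partition functions\<close>

text \<open>The truncation keeps mass from concentrating: each interval has
  \<open>\<rho>\<close>-mass at most its length, so positive total mass must spread over many cells,
  however the singular part of \<open>\<nu>\<close> behaves. The eigenvalue problem is read
  backwards. On H^1_0 with the energy as inner product, the form given by integrating f g against
  \<open>\<nu>\<close> is compact, and an eigenvector of it with eigenvalue S > 0 solves the
  original weak equation with eigenvalue 1/S. Lower bounds for the \<open>\<nu>\<close>-form on
  large subspaces therefore produce many small eigenvalues. The encoding of the count is an obstacle
  of its own: a sum over an infinite set and the dimension of an infinite-dimensional space are both
  0 by convention. Finiteness of the spectrum below x and of the multiplicities has to be known
  before eigenvectors can be counted. It comes from the same argument with K points, which is why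
  that argument treats arbitrary finite independent families of eigenvectors and not
  \<open>eigenvalue_count\<close> itself.\<close>

locale measure_01 =
  fixes \<nu> :: "real measure"
  assumes finite_borel: "finite_borel_measure_01 \<nu>"
begin

sublocale finite_measure \<nu>
  using finite_borel by (simp add: finite_borel_measure_01_def)

lemma sets_borel [simp, measurable_cong]: "sets \<nu> = sets borel"
  using finite_borel by (simp add: finite_borel_measure_01_def)

lemma space_UNIV [simp]: "space \<nu> = UNIV"
  using sets_eq_imp_space_eq[of \<nu> borel] by simp

end

text \<open>The number \<open>n\<close> of cells is kept apart from the mesh \<open>1 / K\<close>,
  so that the induction runs with the mesh fixed. This covers the dyadic cells as well as the equal
  cells of the eigenvalue part.\<close>

lemma sum_measure_equal_cells:
  assumes m: "finite_measure m" "sets m = sets borel" and K: "K > 0"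
  shows "(\<Sum>k<n. measure m {real k / K <.. (real k + 1) / K}) = measure m {0 <.. real n / K}"
proof (induction n)
  case (Suc n)
  interpret finite_measure m by (rule m)
  have "{0 <.. real (Suc n) / K} = {0 <.. real n / K} \<union> {real n / K <.. (real n + 1) / K}"
    using K by (subst ivl_disj_un) (auto simp: field_simps)
  then have "measure m {0 <.. real (Suc n) / K}
      = measure m {0 <.. real n / K} + measure m {real n / K <.. (real n + 1) / K}"
    by (simp only:) (rule finite_measure_Union; auto simp: m)
  with Suc show ?case by simp
qed simp

lemma inj_dyadic_cell: "inj_on (dyadic_cell n) A"
proof (rule inj_onI)
  fix j k assume "dyadic_cell n j = dyadic_cell n k"
  then have "Sup (dyadic_cell n j) = Sup (dyadic_cell n k)" by simp
  then show "j = k" by (simp add: dyadic_cell_def divide_strict_right_mono)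
qed

definition charged_indices :: "real measure \<Rightarrow> nat \<Rightarrow> nat set" where
  "charged_indices \<nu> n = {k. k < 2 ^ n \<and> measure \<nu> (dyadic_cell n k) > 0}"

lemma finite_charged_indices [simp]: "finite (charged_indices \<nu> n)"
  by (simp add: charged_indices_def)

lemma sum_charged_cells:
  "(\<Sum>C\<in>charged_cells \<nu> n. g C) = (\<Sum>k\<in>charged_indices \<nu> n. g (dyadic_cell n k))"
proof -
  have "charged_cells \<nu> n = dyadic_cell n ` charged_indices \<nu> n"
    by (auto simp: charged_cells_def charged_indices_def)
  then show ?thesis by (simp add: sum.reindex[OF inj_dyadic_cell])
qed

definition partition_sum :: "real measure \<Rightarrow> nat \<Rightarrow> real \<Rightarrow> real" where
  "partition_sum \<nu> n q = (\<Sum>k\<in>charged_indices \<nu> n. measure \<nu> (dyadic_cell n k) powr q)"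

lemma beta_n_eq: "beta_n \<nu> n q = ln (partition_sum \<nu> n q) / ln (2 ^ n)"
  by (simp add: beta_n_def partition_sum_def sum_charged_cells)

text \<open>Collects what is used of the absolutely continuous part: a minorant of
  \<open>\<nu>\<close> that gives no interval more than its length and does not vanish.\<close>

locale dominated_measure = measure_01 \<nu> for \<nu> +
  fixes \<rho> :: "real measure"
  assumes \<rho>_finite: "finite_measure \<rho>" and sets_\<rho>: "sets \<rho> = sets borel"
    and \<rho>_le_\<nu>: "A \<in> sets borel \<Longrightarrow> measure \<rho> A \<le> measure \<nu> A"
    and \<rho>_le_lborel: "a \<le> b \<Longrightarrow> measure \<rho> {a<..b} \<le> b - a"
    and \<rho>_pos: "0 < measure \<rho> {0<..1}"

lemma dominated_measure_exists:
  assumes \<nu>: "finite_borel_measure_01 \<nu>" and dec: "lebesgue_decomposition \<nu> \<nu>a \<nu>s"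
    and nz: "emeasure \<nu>a UNIV \<noteq> 0"
  shows "\<exists>\<rho>. dominated_measure \<nu> \<rho>"
proof -
  interpret measure_01 \<nu> by (rule measure_01.intro[OF \<nu>])
  have sets_a: "sets \<nu>a = sets borel" and ac: "absolutely_continuous lborel \<nu>a"
    and le: "\<And>A. A \<in> sets borel \<Longrightarrow> emeasure \<nu>a A \<le> emeasure \<nu> A"
    using dec unfolding lebesgue_decomposition_def by auto
  obtain f where f [measurable]: "f \<in> borel_measurable lborel" and \<nu>a: "density lborel f = \<nu>a"
    using sigma_finite_measure.Radon_Nikodym[OF sigma_finite_lborel ac] sets_a by auto
  define \<rho> where "\<rho> = density lborel (\<lambda>x. min (f x) 1)"
  have sets_\<rho>: "sets \<rho> = sets borel" by (simp add: \<rho>_def)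
  have \<rho>_le: "emeasure \<rho> A \<le> emeasure \<nu> A" if A: "A \<in> sets borel" for A
  proof -
    have "emeasure \<rho> A \<le> emeasure \<nu>a A"
      unfolding \<rho>_def \<nu>a[symmetric] using A
      by (auto simp: emeasure_density intro!: nn_integral_mono mult_right_mono)
    then show ?thesis using le[OF A] by simp
  qed
  have "emeasure \<rho> UNIV \<le> emeasure \<nu> UNIV" by (rule \<rho>_le) simp
  also have "\<dots> < \<infinity>" by (simp add: less_top[symmetric])
  finally have "emeasure \<rho> UNIV < \<infinity>" .
  then have finite: "finite_measure \<rho>"
    by (intro finite_measureI) (simp add: \<rho>_def less_top)
  interpret \<rho>: finite_measure \<rho> by (rule finite)
  have 1: "measure \<rho> A \<le> measure \<nu> A" if "A \<in> sets borel" for A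
    using \<rho>_le[OF that] by (simp add: \<rho>.emeasure_eq_measure emeasure_eq_measure)
  have 2: "measure \<rho> {a<..b} \<le> b - a" if "a \<le> b" for a b
  proof -
    have "emeasure \<rho> {a<..b} = (\<integral>\<^sup>+x. min (f x) 1 * indicator {a<..b} x \<partial>lborel)"
      by (simp add: \<rho>_def emeasure_density)
    also have "\<dots> \<le> (\<integral>\<^sup>+x. indicator {a<..b} x \<partial>lborel)"
      by (intro nn_integral_mono) (auto split: split_indicator)
    also have "\<dots> = ennreal (b - a)" using that by simp
    finally show ?thesis using that by (simp add: \<rho>.emeasure_eq_measure)
  qed
  \<comment> \<open>\<open>min (f x) 1\<close> vanishes only where \<open>f\<close> does, so
    \<open>\<rho> = 0\<close> would force \<open>\<nu>a = 0\<close>. Off \<open>(0,1]\<close> the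
    measure \<open>\<rho>\<close> is zero anyway, because \<open>\<rho> \<le> \<nu>\<close>.\<close>
  have "measure \<rho> {0<..1} \<noteq> 0"
  proof
    assume 0: "measure \<rho> {0<..1} = 0"
    have "emeasure \<nu> (- {0<..<1}) = 0" using \<nu> by (simp add: finite_borel_measure_01_def)
    moreover have "emeasure \<nu> (- {0<..1}) \<le> emeasure \<nu> (- {0<..<1})"
      by (intro emeasure_mono) auto
    ultimately have "emeasure \<rho> (- {0<..1}) = 0"
      using \<rho>_le[of "- {0<..1}"] by simp
    moreover have "emeasure \<rho> {0<..1} = 0" using 0 by (simp add: \<rho>.emeasure_eq_measure)
    ultimately have "emeasure \<rho> ({0<..1} \<union> - {0<..1}) = 0"
      by (subst plus_emeasure[symmetric]) (auto simp: sets_\<rho>)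
    then have "(\<integral>\<^sup>+x. min (f x) 1 \<partial>lborel) = 0"
      by (simp add: \<rho>_def emeasure_density)
    then have "AE x in lborel. min (f x) 1 = 0" by (simp add: nn_integral_0_iff_AE)
    then have "AE x in lborel. f x = 0" by eventually_elim (auto simp: min_def split: if_splits)
    then have "(\<integral>\<^sup>+x. f x \<partial>lborel) = 0" by (simp add: nn_integral_0_iff_AE)
    then have "emeasure \<nu>a UNIV = 0" by (simp flip: \<nu>a add: emeasure_density)
    with nz show False by simp
  qed
  then have 3: "0 < measure \<rho> {0<..1}" using measure_nonneg[of \<rho>] by (simp add: less_le)
  have "dominated_measure \<nu> \<rho>"
    by (intro dominated_measure.intro dominated_measure_axioms.intro measure_01_axioms finite sets_\<rho> 1 2 3)
  then show ?thesis ..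
qed

context dominated_measure
begin

lemma sum_\<nu>_dyadic: "(\<Sum>k<2^n. measure \<nu> (dyadic_cell n k)) = measure \<nu> {0<..1}"
  using sum_measure_equal_cells[OF finite_measure_axioms sets_borel, of "2^n" "2^n"] by (simp add: dyadic_cell_def)

lemma sum_\<rho>_dyadic: "(\<Sum>k<2^n. measure \<rho> (dyadic_cell n k)) = measure \<rho> {0<..1}"
  using sum_measure_equal_cells[OF \<rho>_finite sets_\<rho>, of "2^n" "2^n"] by (simp add: dyadic_cell_def)

lemma dyadic_cell_borel [measurable, simp]: "dyadic_cell n k \<in> sets borel"
  by (simp add: dyadic_cell_def)

text \<open>Stands in for Jensen's inequality, which would give mass^q N^(1-q) for N = 2^n cells.
  The elementary bound splits at t = 1/N: below it t^q is at most its value there, above it the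
  factor t^(q-1) is. The price is a larger constant, which disappears from \<open>beta_n\<close> in
  the limit.\<close>

lemma partition_sum_upper:
  assumes q: "0 \<le> q" "q \<le> 1"
  shows "partition_sum \<nu> n q \<le> (1 + measure \<nu> {0<..1}) * (2 ^ n) powr (1 - q)"
proof -
  define N :: real where "N = 2 ^ n"
  have N: "N > 0" by (simp add: N_def)
  have N': "(1 / N) powr a = N powr (- a)" for a
    using N by (simp add: powr_minus_divide powr_divide)
  have "t powr q \<le> N powr (1 - q) * (1 / N + t)" if t: "t > 0" for t
  proof (cases "t \<le> 1 / N")
    case True
    then have "t powr q \<le> (1 / N) powr q" using t q by (intro powr_mono2) auto
    also have "\<dots> = N powr (1 - q) * (1 / N)"
      using N by (simp add: N' powr_diff powr_minus_divide)
    also have "\<dots> \<le> N powr (1 - q) * (1 / N + t)" using t by (intro mult_left_mono) auto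
    finally show ?thesis .
  next
    case False
    have "t powr q = t * t powr (q - 1)" using t by (simp add: powr_diff)
    also have "\<dots> \<le> t * (1 / N) powr (q - 1)"
      using False t N q by (intro mult_left_mono powr_mono2') auto
    also have "\<dots> = N powr (1 - q) * t" by (simp add: N')
    also have "\<dots> \<le> N powr (1 - q) * (1 / N + t)" using N by (intro mult_left_mono) auto
    finally show ?thesis .
  qed
  then have "partition_sum \<nu> n q \<le>
      (\<Sum>k\<in>charged_indices \<nu> n. N powr (1 - q) * (1 / N + measure \<nu> (dyadic_cell n k)))"
    unfolding partition_sum_def by (intro sum_mono) (auto simp: charged_indices_def)
  also have "\<dots> \<le> (\<Sum>k<2^n. N powr (1 - q) * (1 / N + measure \<nu> (dyadic_cell n k)))"
    using N by (intro sum_mono2) (auto simp: charged_indices_def)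
  also have "\<dots> = N powr (1 - q) * (1 + measure \<nu> {0<..1})"
    using N by (simp add: sum_distrib_left[symmetric] sum.distrib sum_\<nu>_dyadic) (simp add: N_def)
  finally show ?thesis by (simp add: N_def mult.commute)
qed

lemma partition_sum_lower:
  assumes q: "0 \<le> q" "q \<le> 1"
  shows "measure \<rho> {0<..1} * (2 ^ n) powr (1 - q) \<le> partition_sum \<nu> n q"
proof -
  define N :: real where "N = 2 ^ n"
  have N: "N > 0" by (simp add: N_def)
  have N': "(1 / N) powr a = N powr (- a)" for a
    using N by (simp add: powr_minus_divide powr_divide)
  let ?C = "dyadic_cell n"
  \<comment> \<open>One factor of the \<open>\<rho>\<close>-mass is split off because the exponent
    \<open>q - 1\<close> is nonpositive and reverses the bound of the mass by the length. The
    passage from \<open>\<rho>\<close> to \<open>\<nu>\<close> is made afterwards, under the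
    nonnegative exponent \<open>q\<close>.\<close>
  have term_le: "measure \<rho> (?C k) * N powr (1 - q) \<le> measure \<nu> (?C k) powr q"
    if pos: "measure \<rho> (?C k) > 0" for k
  proof -
    have "measure \<rho> (?C k) \<le> 1 / N"
      using \<rho>_le_lborel[of "real k / 2 ^ n" "(real k + 1) / 2 ^ n"]
      by (simp add: dyadic_cell_def N_def field_simps)
    then have "(1 / N) powr (q - 1) \<le> measure \<rho> (?C k) powr (q - 1)"
      using q pos by (intro powr_mono2') auto
    then have "measure \<rho> (?C k) * N powr (1 - q) \<le> measure \<rho> (?C k) * measure \<rho> (?C k) powr (q - 1)"
      using pos by (simp add: N')
    also have "\<dots> = measure \<rho> (?C k) powr q" using pos by (simp add: powr_diff)
    also have "\<dots> \<le> measure \<nu> (?C k) powr q"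
      using q by (intro powr_mono2 \<rho>_le_\<nu>) auto
    finally show ?thesis .
  qed
  have "measure \<rho> {0<..1} * N powr (1 - q) = (\<Sum>k<2^n. measure \<rho> (?C k) * N powr (1 - q))"
    by (simp add: sum_\<rho>_dyadic flip: sum_distrib_right)
  \<comment> \<open>The discarded terms are zero. The remaining cells are charged by
    \<open>\<nu>\<close> as well, and no negative power of 0, which is 0 by convention, has to be
    estimated.\<close>
  also have "\<dots> = (\<Sum>k | k < 2^n \<and> measure \<rho> (?C k) > 0. measure \<rho> (?C k) * N powr (1 - q))"
    by (intro sum.mono_neutral_right) (auto simp: less_le)
  also have "\<dots> \<le> (\<Sum>k | k < 2^n \<and> measure \<rho> (?C k) > 0. measure \<nu> (?C k) powr q)"
    by (intro sum_mono term_le) simp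
  also have "\<dots> \<le> partition_sum \<nu> n q"
    unfolding partition_sum_def charged_indices_def
    by (intro sum_mono2) (auto intro: less_le_trans[OF _ \<rho>_le_\<nu>])
  finally show ?thesis by (simp add: N_def)
qed

text \<open>At \<open>q = 0\<close> the lower bound says that some cell is charged, which settles
  every real \<open>q\<close>. Positivity makes the logarithms in \<open>beta_n\<close>
  genuine.\<close>

lemma partition_sum_pos: "partition_sum \<nu> n q > 0"
proof -
  have "0 < measure \<rho> {0<..1} * (2 ^ n) powr (1 - 0)" using \<rho>_pos by simp
  also have "\<dots> \<le> partition_sum \<nu> n 0" by (rule partition_sum_lower) auto
  finally have "charged_indices \<nu> n \<noteq> {}" by (auto simp: partition_sum_def)
  then show ?thesis
    unfolding partition_sum_def by (intro sum_pos) (auto simp: charged_indices_def)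
qed

lemma beta_n_bounds:
  assumes q: "0 \<le> q" "q \<le> 1" and n: "n > 0"
  shows "1 - q + ln (measure \<rho> {0<..1}) / ln (2 ^ n) \<le> beta_n \<nu> n q"
    "beta_n \<nu> n q \<le> 1 - q + ln (1 + measure \<nu> {0<..1}) / ln (2 ^ n)"
proof -
  define L where "L = ln (2 ^ n :: real)"
  have L: "L > 0" using n by (simp add: L_def)
  have "ln (measure \<rho> {0<..1} * (2 ^ n) powr (1 - q)) \<le> ln (partition_sum \<nu> n q)"
    using \<rho>_pos partition_sum_lower[OF q] by (intro ln_mono) auto
  then have "ln (measure \<rho> {0<..1}) + (1 - q) * ln (2 ^ n) \<le> ln (partition_sum \<nu> n q)"
    using \<rho>_pos by (simp add: ln_mult_pos ln_powr)
  then have "(ln (measure \<rho> {0<..1}) + (1 - q) * L) / L \<le> ln (partition_sum \<nu> n q) / L"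
    using L unfolding L_def[symmetric] by (intro divide_right_mono) auto
  then show "1 - q + ln (measure \<rho> {0<..1}) / ln (2 ^ n) \<le> beta_n \<nu> n q"
    using L unfolding beta_n_eq L_def[symmetric] by (simp add: add_divide_distrib)
  have T: "1 + measure \<nu> {0<..1} > 0" using measure_nonneg[of \<nu>] by (simp add: add_pos_nonneg)
  have "ln (partition_sum \<nu> n q) \<le> ln ((1 + measure \<nu> {0<..1}) * (2 ^ n) powr (1 - q))"
    using partition_sum_upper[OF q] partition_sum_pos T by (intro ln_mono) auto
  then have "ln (partition_sum \<nu> n q) \<le> ln (1 + measure \<nu> {0<..1}) + (1 - q) * ln (2 ^ n)"
    using T by (simp add: ln_mult_pos ln_powr)
  then have "ln (partition_sum \<nu> n q) / L \<le> (ln (1 + measure \<nu> {0<..1}) + (1 - q) * L) / L"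
    using L unfolding L_def[symmetric] by (intro divide_right_mono) auto
  then show "beta_n \<nu> n q \<le> 1 - q + ln (1 + measure \<nu> {0<..1}) / ln (2 ^ n)"
    using L unfolding beta_n_eq L_def[symmetric] by (simp add: add_divide_distrib)
qed

lemma const_over_ln_pow2: "(\<lambda>n. a + c / ln (2 ^ n :: real)) \<longlonglongrightarrow> a"
proof -
  have "(\<lambda>n. (c / ln 2) * (1 / real n)) \<longlonglongrightarrow> (c / ln 2) * 0"
    by (intro tendsto_intros lim_1_over_n)
  then have "(\<lambda>n. a + c / ln (2 ^ n :: real)) \<longlonglongrightarrow> a + 0"
    by (intro tendsto_add tendsto_const) (simp add: ln_realpow mult.commute)
  then show ?thesis by simp
qed

lemma beta_n_tendsto:
  assumes q: "0 \<le> q" "q \<le> 1"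
  shows "(\<lambda>n. beta_n \<nu> n q) \<longlonglongrightarrow> 1 - q"
  by (rule real_tendsto_sandwich[OF _ _ const_over_ln_pow2 const_over_ln_pow2])
    (auto intro!: eventually_mono[OF eventually_gt_at_top[of 0]] beta_n_bounds q)

lemma beta_eq:
  assumes "0 \<le> q" "q \<le> 1"
  shows "beta \<nu> q = ereal (1 - q)" "beta_lower \<nu> q = ereal (1 - q)"
  using beta_n_tendsto[OF assms] unfolding beta_def beta_lower_def
  by (auto intro!: lim_imp_Limsup lim_imp_Liminf)

text \<open>Each cell has mass less than \<open>2 ^ n\<close>, so \<open>\<nu>(C)\<^sup>q 2\<^sup>-\<^sup>n\<^sup>q\<close> decreases in \<open>q\<close>.\<close>

lemma beta_n_minus_strict_antimono:
  assumes n: "n > 0" "measure \<nu> UNIV < 2 ^ n" and q: "q < q'"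
  shows "beta_n \<nu> n q' - q' < beta_n \<nu> n q - q"
proof -
  let ?N = "2 ^ n :: real"
  define L where "L = ln ?N"
  have L: "L > 0" using n by (simp add: L_def)
  have ne: "charged_indices \<nu> n \<noteq> {}"
    using partition_sum_pos[of n 0] by (auto simp: partition_sum_def)
  have "partition_sum \<nu> n q' < (\<Sum>k\<in>charged_indices \<nu> n. measure \<nu> (dyadic_cell n k) powr q * ?N powr (q' - q))"
    unfolding partition_sum_def
  proof (intro sum_strict_mono)
    fix k assume "k \<in> charged_indices \<nu> n"
    then have pos: "measure \<nu> (dyadic_cell n k) > 0" by (simp add: charged_indices_def)
    have "measure \<nu> (dyadic_cell n k) < ?N"
      using finite_measure_mono[of "dyadic_cell n k" UNIV] n by simp
    then have "measure \<nu> (dyadic_cell n k) powr (q' - q) < ?N powr (q' - q)"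
      using q by (intro powr_less_mono2) auto
    then have "measure \<nu> (dyadic_cell n k) powr q * measure \<nu> (dyadic_cell n k) powr (q' - q)
        < measure \<nu> (dyadic_cell n k) powr q * ?N powr (q' - q)"
      using pos by simp
    then show "measure \<nu> (dyadic_cell n k) powr q' < measure \<nu> (dyadic_cell n k) powr q * ?N powr (q' - q)"
      by (simp flip: powr_add)
  qed (use ne in auto)
  also have "\<dots> = partition_sum \<nu> n q * ?N powr (q' - q)"
    by (simp add: partition_sum_def sum_distrib_right)
  finally have "ln (partition_sum \<nu> n q') < ln (partition_sum \<nu> n q * ?N powr (q' - q))"
    using partition_sum_pos by (subst ln_less_cancel_iff) auto
  then have "ln (partition_sum \<nu> n q') < ln (partition_sum \<nu> n q) + (q' - q) * ln ?N"
    using partition_sum_pos[of n q] by (simp add: ln_mult_pos ln_powr)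
  then have "ln (partition_sum \<nu> n q') / L < (ln (partition_sum \<nu> n q) + (q' - q) * L) / L"
    using L unfolding L_def[symmetric] by (intro divide_strict_right_mono) auto
  then show ?thesis
    using L unfolding beta_n_eq L_def[symmetric] by (simp add: add_divide_distrib)
qed

lemma continuous_on_beta_n: "continuous_on A (beta_n \<nu> n)"
proof -
  have "continuous_on A (partition_sum \<nu> n)"
    unfolding partition_sum_def by (intro continuous_intros) (auto simp: charged_indices_def)
  then have "continuous_on A (\<lambda>q. ln (partition_sum \<nu> n q) / ln (2 ^ n))"
    using partition_sum_pos[of n] unfolding divide_inverse
    by (intro continuous_on_mult_right continuous_on_ln) (auto simp: less_imp_neq[symmetric])
  then show ?thesis by (simp add: beta_n_eq)
qed

lemma fixed_q_tendsto: "fixed_q \<nu> \<longlonglongrightarrow> 1 / 2"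
proof (rule LIMSEQ_I)
  fix e :: real assume e: "e > 0"
  \<comment> \<open>The cap 1/2 keeps both test points in [0,1], where the limit is known, and makes
    the fixed point nonnegative; e/2 gives \<open>d < e\<close>.\<close>
  define d where "d = min (e / 2) (1 / 2)"
  have d: "0 < d" "d \<le> 1 / 2" "d < e" using e by (auto simp: d_def min_def)
  have "\<forall>\<^sub>F n in sequentially. beta_n \<nu> n (1 / 2 - d) > 1 / 2 - d"
    by (rule order_tendstoD(1)[OF beta_n_tendsto]) (use d in auto)
  moreover have "\<forall>\<^sub>F n in sequentially. beta_n \<nu> n (1 / 2 + d) < 1 / 2 + d"
    by (rule order_tendstoD(2)[OF beta_n_tendsto]) (use d in auto)
  moreover have "\<forall>\<^sub>F n in sequentially. measure \<nu> UNIV < 2 ^ n"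
    using filterlim_realpow_sequentially_gt1[of "2::real"]
    by (auto simp: filterlim_at_top_dense dest: filterlim_at_infinity_imp_filterlim_at_top)
  ultimately have "\<forall>\<^sub>F n in sequentially. norm (fixed_q \<nu> n - 1 / 2) < e"
    using eventually_gt_at_top[of 0]
  proof eventually_elim
    case (elim n)
    have "\<exists>q\<ge>1 / 2 - d. q \<le> 1 / 2 + d \<and> beta_n \<nu> n q - q = 0"
      using elim(1,2) d(1)
      by (intro IVT2' continuous_on_diff continuous_on_beta_n continuous_on_id) simp_all
    then obtain q where q: "1 / 2 - d \<le> q" "q \<le> 1 / 2 + d" "beta_n \<nu> n q = q" by auto
    have uniq: "q' = q" if "beta_n \<nu> n q' = q'" for q'
      using beta_n_minus_strict_antimono[of n q q'] beta_n_minus_strict_antimono[of n q' q]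
        elim that q(3) by (cases q q' rule: linorder_cases) auto
    have "q \<ge> 0" using q(1) d(2) by linarith
    then have "fixed_q \<nu> n = q"
      unfolding fixed_q_def using q(3) by (intro the_equality) (blast intro: uniq)+
    then show ?case using q d by (auto simp: abs_if)
  qed
  then show "\<exists>no. \<forall>n\<ge>no. norm (fixed_q \<nu> n - 1 / 2) < e"
    by (simp add: eventually_sequentially)
qed

text \<open>Alternative (a) holds with \<open>\<epsilon> = 1/2\<close>, since the interval (0, 1/2)
  lies inside [0,1], where the sequence converges.\<close>

lemma Lq_regular: "Lq_regular \<nu>"
proof -
  have "upper_q \<nu> = ereal (1 / 2)"
    unfolding upper_q_def using fixed_q_tendsto by (intro lim_imp_Limsup) auto
  moreover have "\<forall>q\<in>{1/2 - 1/2<..<1/2}. beta \<nu> q = beta_lower \<nu> q"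
    using beta_eq by auto
  ultimately show ?thesis
    unfolding Lq_regular_def by (intro exI[of _ "1/2"] conjI disjI1 exI[of _ "1/2"]) auto
qed

end

section \<open>Compact symmetric forms on a Hilbert space\<close>

text \<open>Gaussian elimination, one equation per induction step. It is phrased with coefficients
  because it serves two kinds of linear conditions: orthogonality to given vectors and vanishing at
  given points.\<close>

lemma underdetermined_system_nontrivial:
  fixes \<phi> :: "'j \<Rightarrow> 'i \<Rightarrow> real"
  assumes "finite J" "finite I" "card J < card I"
  shows "\<exists>c. (\<exists>i\<in>I. c i \<noteq> 0) \<and> (\<forall>j\<in>J. (\<Sum>i\<in>I. c i * \<phi> j i) = 0)"
  using assms
proof (induction J arbitrary: I \<phi> rule: finite_induct)
  case empty
  then obtain i where "i \<in> I" by fastforce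
  then show ?case by (intro exI[of _ "\<lambda>_. 1"]) auto
next
  case (insert j J)
  show ?case
  proof (cases "\<forall>i\<in>I. \<phi> j i = 0")
    case True
    obtain c where "\<exists>i\<in>I. c i \<noteq> 0" "\<forall>j\<in>J. (\<Sum>i\<in>I. c i * \<phi> j i) = 0"
      using insert.IH[of I \<phi>] insert.prems insert.hyps by auto
    with True show ?thesis by (intro exI[of _ c]) auto
  next
    case False
    then obtain i0 where i0: "i0 \<in> I" "\<phi> j i0 \<noteq> 0" by auto
    define I' where "I' = I - {i0}"
    \<comment> \<open>The coefficients left after equation \<open>j\<close> has been solved for the
      unknown \<open>i0\<close> and substituted into the others. The vector \<open>d\<close> below
      restores that unknown.\<close>
    define \<psi> where "\<psi> = (\<lambda>k i. \<phi> k i - \<phi> k i0 * \<phi> j i / \<phi> j i0)"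
    have fin: "finite I'" and I: "I = insert i0 I'" "i0 \<notin> I'"
      using insert.prems i0 by (auto simp: I'_def)
    have "card J < card I'"
      using insert.prems insert.hyps i0 by (simp add: I'_def)
    then obtain c where c: "\<exists>i\<in>I'. c i \<noteq> 0" "\<And>k. k \<in> J \<Longrightarrow> (\<Sum>i\<in>I'. c i * \<psi> k i) = 0"
      using insert.IH[of I' \<psi>] fin by blast
    define s where "s = (\<Sum>i\<in>I'. c i * \<phi> j i)"
    define d where "d = (\<lambda>i. if i = i0 then - s / \<phi> j i0 else c i)"
    have sum_d: "(\<Sum>i\<in>I. d i * \<phi> k i) = (\<Sum>i\<in>I'. c i * \<phi> k i) - s / \<phi> j i0 * \<phi> k i0" for k
    proof -
      have "(\<Sum>i\<in>I'. d i * \<phi> k i) = (\<Sum>i\<in>I'. c i * \<phi> k i)"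
        using I by (intro sum.cong) (auto simp: d_def)
      then show ?thesis
        using I fin by (simp add: d_def)
    qed
    have "(\<Sum>i\<in>I. d i * \<phi> k i) = 0" if "k \<in> insert j J" for k
    proof (cases "k = j")
      case True
      then show ?thesis using i0 by (simp add: sum_d s_def)
    next
      case False
      then have "0 = (\<Sum>i\<in>I'. c i * \<psi> k i)" using that c by auto
      also have "\<dots> = (\<Sum>i\<in>I'. c i * \<phi> k i) - s / \<phi> j i0 * \<phi> k i0"
        by (simp add: \<psi>_def s_def algebra_simps sum_subtractf sum_distrib_left sum_divide_distrib)
      finally show ?thesis by (simp add: sum_d)
    qed
    moreover have "\<exists>i\<in>I. d i \<noteq> 0"
      using c(1) I by (auto simp: d_def)
    ultimately show ?thesis by blast
  qed
qed

text \<open>Compactness is stated for the form itself, so that no operator representing it has to be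
  built: a sequence in the unit ball has a subsequence that is Cauchy for the quadratic
  form.\<close>

locale compact_symmetric_form =
  fixes Q :: "'a::{real_inner, complete_space} \<Rightarrow> 'a \<Rightarrow> real"
  assumes bilinear: "bounded_bilinear Q"
    and symmetric: "Q x y = Q y x"
    and compact: "(\<And>n. norm (X n) \<le> 1) \<Longrightarrow>
      \<exists>k :: nat \<Rightarrow> nat. strict_mono k \<and>
        (\<forall>e>0. \<exists>N. \<forall>m\<ge>N. \<forall>n\<ge>N. Q (X (k m) - X (k n)) (X (k m) - X (k n)) < e)"
begin

interpretation Q: bounded_bilinear Q by (rule bilinear)

lemma Q_lincomb: "Q (x + t *\<^sub>R y) (x + t *\<^sub>R y) = Q x x + 2 * t * Q x y + t\<^sup>2 * Q y y"
  using symmetric[of x y]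
  by (simp add: Q.add_left Q.add_right Q.scaleR_left Q.scaleR_right power2_eq_square algebra_simps)

lemma Q_scale: "Q (t *\<^sub>R x) (t *\<^sub>R x) = t\<^sup>2 * Q x x"
  by (simp add: Q.scaleR_left Q.scaleR_right power2_eq_square)

lemma Q_parallelogram: "Q (x + y) (x + y) + Q (x - y) (x - y) = 2 * Q x x + 2 * Q y y"
  by (simp add: Q.add_left Q.add_right Q.diff_left Q.diff_right)

text \<open>The Rayleigh quotient attains its supremum on \<open>U\<close>. A maximizing sequence is
  shown to be Cauchy in norm, so weak limits are avoided. The vector \<open>v\<close> ensures that
  the supremum \<open>S\<close> is at least \<open>c\<close>, hence positive, which the Cauchy
  estimate needs.\<close>

lemma constrained_maximizer:
  assumes U: "subspace U" "closed U" and v: "v \<in> U" "v \<noteq> 0"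
    and c: "c > 0" "c * (norm v)\<^sup>2 \<le> Q v v"
  obtains g S where "g \<in> U" "norm g = 1" "c \<le> S" "Q g g = S"
    "\<And>h. h \<in> U \<Longrightarrow> Q h h \<le> S * (norm h)\<^sup>2"
proof -
  obtain K where K: "\<And>x y. norm (Q x y) \<le> norm x * norm y * K" "K > 0"
    using Q.pos_bounded by blast
  define A where "A = (\<lambda>x. Q x x) ` {x \<in> U. norm x = 1}"
  define S where "S = Sup A"
  have bdd: "bdd_above A"
  proof (rule bdd_aboveI)
    fix a assume "a \<in> A"
    then obtain x where "norm x = 1" "a = Q x x" by (auto simp: A_def)
    then show "a \<le> K" using K(1)[of x x] by simp
  qed
  have le_S: "Q h h \<le> S * (norm h)\<^sup>2" if h: "h \<in> U" for h
  proof (cases "h = 0")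
    case False
    let ?u = "(1 / norm h) *\<^sub>R h"
    have "?u \<in> {x \<in> U. norm x = 1}"
      using h False U by (auto simp: subspace_scale)
    then have "Q ?u ?u \<le> S"
      unfolding S_def A_def using bdd[unfolded A_def] by (intro cSup_upper) auto
    then show ?thesis
      using False unfolding Q_scale by (simp add: field_simps power2_eq_square)
  qed (simp add: Q.zero_left)
  have "c * (norm v)\<^sup>2 \<le> S * (norm v)\<^sup>2" using le_S[OF v(1)] c by linarith
  then have cS: "c \<le> S" using v by auto
  then have S: "S > 0" using c by simp
  have "A \<noteq> {}"
  proof -
    have "(1 / norm v) *\<^sub>R v \<in> {x \<in> U. norm x = 1}"
      using v U by (auto simp: subspace_scale)
    then show ?thesis by (auto simp: A_def)
  qed
  then have "\<exists>a\<in>A. S - 1 / Suc n < a" for n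
    using less_cSup_iff[OF _ bdd, of "S - 1 / Suc n"] unfolding S_def[symmetric] by simp
  then have "\<exists>x. x \<in> U \<and> norm x = 1 \<and> S - 1 / Suc n < Q x x" for n
    unfolding A_def by blast
  then obtain X where X: "\<And>n. X n \<in> U" "\<And>n. norm (X n) = 1" "\<And>n. S - 1 / Suc n < Q (X n) (X n)"
    by metis
  obtain k where k: "strict_mono (k :: nat \<Rightarrow> nat)"
    and cau: "\<And>e. e > 0 \<Longrightarrow> \<exists>N. \<forall>m\<ge>N. \<forall>n\<ge>N. Q (X (k m) - X (k n)) (X (k m) - X (k n)) < e"
    using compact[of X] X(2) by auto
  define Y where "Y = X \<circ> k"
  have Y: "Y n \<in> U" "norm (Y n) = 1" "S - 1 / Suc n < Q (Y n) (Y n)" for n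
  proof -
    have "1 / Suc (k n) \<le> 1 / Suc n"
      using seq_suble[OF k, of n] by (simp add: frac_le)
    then show "S - 1 / Suc n < Q (Y n) (Y n)"
      using X(3)[of "k n"] unfolding Y_def o_def by linarith
  qed (auto simp: Y_def X)
  have "Cauchy Y"
  proof (rule CauchyI)
    fix e :: real assume e: "e > 0"
    \<comment> \<open>The estimate below loses 4 d through the two nearly maximal values and d
      through the Cauchy property for \<open>Q\<close>; the choice makes 5 d smaller than S
      e^2.\<close>
    define d where "d = S * e\<^sup>2 / 8"
    have d: "d > 0" using S e by (simp add: d_def)
    obtain N1 where N1: "\<And>m n. m \<ge> N1 \<Longrightarrow> n \<ge> N1 \<Longrightarrow> Q (Y m - Y n) (Y m - Y n) < d"
      using cau[OF d] unfolding Y_def o_def by blast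
    obtain N2 where N2: "1 / Suc N2 < d" using d nat_approx_posE by metis
    show "\<exists>M. \<forall>m\<ge>M. \<forall>n\<ge>M. norm (Y m - Y n) < e"
    proof (intro exI allI impI)
      fix m n assume mn: "m \<ge> max N1 N2" "n \<ge> max N1 N2"
      have near: "S - d < Q (Y i) (Y i)" if "i \<ge> max N1 N2" for i
      proof -
        have "1 / Suc i \<le> 1 / Suc N2" using that by (simp add: frac_le)
        then show ?thesis using Y(3)[of i] N2 by linarith
      qed
      \<comment> \<open>Both forms satisfy the parallelogram law, so nearly maximal vectors that are close
        with respect to \<open>Q\<close> are close in norm.\<close>
      have "Q (Y m + Y n) (Y m + Y n) \<le> S * (norm (Y m + Y n))\<^sup>2"
        using U Y(1) by (intro le_S subspace_add)
      moreover have "(norm (Y m + Y n))\<^sup>2 + (norm (Y m - Y n))\<^sup>2 = 4"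
        using Y(2) by (simp add: power2_norm_eq_inner inner_add inner_diff inner_commute norm_eq_1)
      then have "(norm (Y m + Y n))\<^sup>2 = 4 - (norm (Y m - Y n))\<^sup>2" by linarith
      ultimately have "S * (norm (Y m - Y n))\<^sup>2 < 5 * d"
        using Q_parallelogram[of "Y m" "Y n"] near[OF mn(1)] near[OF mn(2)] N1[of m n] mn
        by (simp add: algebra_simps)
      also have "\<dots> < S * e\<^sup>2" using S e by (simp add: d_def)
      finally have "(norm (Y m - Y n))\<^sup>2 < e\<^sup>2" using S by simp
      then show "norm (Y m - Y n) < e" using e by (simp add: power_less_imp_less_base)
    qed
  qed
  then obtain g where g: "Y \<longlonglongrightarrow> g" using Cauchy_convergent_iff convergent_def by blast
  have gU: "g \<in> U" using U(2) Y(1) g closed_sequentially by blast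
  have g1: "norm g = 1" using tendsto_norm[OF g] Y(2) by (simp add: LIMSEQ_const_iff)
  have "(\<lambda>n. S - 1 / Suc n) \<longlonglongrightarrow> S - 0"
    by (intro tendsto_intros LIMSEQ_Suc[OF lim_1_over_n, unfolded o_def]) 
  moreover have "(\<lambda>n. Q (Y n) (Y n)) \<longlonglongrightarrow> Q g g" by (intro Q.tendsto g)
  ultimately have "S - 0 \<le> Q g g"
    by (rule LIMSEQ_le) (use Y(3) in \<open>auto intro: less_imp_le\<close>)
  moreover have "Q g g \<le> S" using le_S[OF gU] g1 by simp
  ultimately have "Q g g = S" by simp
  from that[OF gU g1 cS this le_S] show ?thesis .
qed

text \<open>First-order condition: along \<open>g + t h\<close> the gap between the two sides of
  \<open>max\<close> is a nonnegative quadratic polynomial in \<open>t\<close> vanishing at 0, so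
  its linear coefficient is zero. Only directions in \<open>U\<close> are covered.\<close>

lemma constrained_maximizer_stationary:
  assumes U: "subspace U" and g: "g \<in> U" "norm g = 1" "Q g g = S"
    and max: "\<And>h. h \<in> U \<Longrightarrow> Q h h \<le> S * (norm h)\<^sup>2" and h: "h \<in> U"
  shows "Q g h = S * inner g h"
proof -
  define a where "a = Q g h - S * inner g h"
  define b where "b = S * (norm h)\<^sup>2 - Q h h"
  have b: "b \<ge> 0" using max[OF h] by (simp add: b_def)
  have quad: "2 * t * a \<le> t\<^sup>2 * b" for t
  proof -
    have "Q (g + t *\<^sub>R h) (g + t *\<^sub>R h) \<le> S * (norm (g + t *\<^sub>R h))\<^sup>2"
      using U g h by (intro max subspace_add subspace_scale)
    moreover have "(norm (g + t *\<^sub>R h))\<^sup>2 = 1 + 2 * t * inner g h + t\<^sup>2 * (norm h)\<^sup>2"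
      using g(2) unfolding power2_norm_eq_inner norm_eq_1
      by (simp add: inner_add_left inner_add_right inner_commute[of h g] power2_eq_square algebra_simps)
    ultimately show ?thesis
      unfolding Q_lincomb g(3) a_def b_def by (simp add: algebra_simps)
  qed
  \<comment> \<open>The minimizing choice would be t = a/b; the summand 1 in the denominator also
    handles b = 0.\<close>
  have "2 * (a / (b + 1)) * a \<le> (a / (b + 1))\<^sup>2 * b" by (rule quad)
  also have "\<dots> \<le> (a / (b + 1)) * a * 1"
  proof -
    have "(a / (b + 1))\<^sup>2 * b = (a / (b + 1)) * a * (b / (b + 1))"
      by (simp add: power2_eq_square)
    moreover have "(a / (b + 1)) * a \<ge> 0" using b by simp
    ultimately show ?thesis using b by (simp only:) (intro mult_left_mono, auto)
  qed
  finally have "(a * a) / (b + 1) \<le> 0" by simp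
  then have "a * a \<le> 0" using b by (simp add: divide_le_0_iff)
  then have "a = 0" by (metis mult_eq_0_iff not_square_less_zero order_le_less)
  then show ?thesis by (simp add: a_def)
qed

text \<open>Variational principle. As long as fewer than \<open>card B\<close> eigenvectors have
  been found, some nonzero vector of \<open>span B\<close> is orthogonal to all of them, so the
  maximum over their orthogonal complement is still at least \<open>c\<close>, and a maximizer is
  the next eigenvector.\<close>

theorem orthonormal_eigenvectors:
  assumes "finite B" "independent B" "c > 0" "\<And>v. v \<in> span B \<Longrightarrow> c * (norm v)\<^sup>2 \<le> Q v v"
  shows "\<exists>F. finite F \<and> card F = card B \<and> pairwise orthogonal F \<and> (\<forall>e\<in>F. norm e = 1) \<and>
    (\<forall>e\<in>F. \<exists>S\<ge>c. \<forall>h. Q e h = S * inner e h)"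
proof -
  have "\<exists>F. finite F \<and> card F = n \<and> pairwise orthogonal F \<and> (\<forall>e\<in>F. norm e = 1) \<and>
    (\<forall>e\<in>F. \<exists>S\<ge>c. \<forall>h. Q e h = S * inner e h)" if "n \<le> card B" for n
    using that
  proof (induction n)
    case 0
    show ?case by (intro exI[of _ "{}"]) auto
  next
    case (Suc n)
    then obtain F where F: "finite F" "card F = n" "pairwise orthogonal F" "\<And>e. e \<in> F \<Longrightarrow> norm e = 1"
      "\<And>e. e \<in> F \<Longrightarrow> \<exists>S\<ge>c. \<forall>h. Q e h = S * inner e h" by auto
    define U where "U = {h. \<forall>e\<in>F. inner e h = 0}"
    have U: "subspace U" by (auto simp: U_def subspace_def inner_add)
    have "U = (\<Inter>e\<in>F. {h. inner e h = 0})" by (auto simp: U_def)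
    moreover have "closed {h. inner e h = 0}" for e :: 'a
      by (intro closed_Collect_eq continuous_intros)
    ultimately have cU: "closed U" by auto
    have "card F < card B" using F(2) Suc.prems by simp
    then obtain r where r: "\<exists>b\<in>B. r b \<noteq> 0" "\<And>e. e \<in> F \<Longrightarrow> (\<Sum>b\<in>B. r b * inner e b) = 0"
      using underdetermined_system_nontrivial[OF F(1) assms(1), of "\<lambda>e b. inner e b"] by blast
    define v where "v = (\<Sum>b\<in>B. r b *\<^sub>R b)"
    have "v \<in> U" using r(2) by (auto simp: U_def v_def inner_sum_right)
    moreover have "v \<noteq> 0"
      using r(1) assms(1,2) unfolding v_def by (auto simp: dependent_finite)
    moreover have "v \<in> span B" unfolding v_def by (intro span_sum span_scale span_base)
    ultimately obtain g S where g: "g \<in> U" "norm g = 1" "c \<le> S" "Q g g = S"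
      and max: "\<And>h. h \<in> U \<Longrightarrow> Q h h \<le> S * (norm h)\<^sup>2"
      using constrained_maximizer[OF U cU] assms(3,4) by metis
    have gF: "inner g e = 0" "Q g e = 0" if "e \<in> F" for e
    proof -
      show "inner g e = 0" using g(1) that by (simp add: U_def inner_commute)
      then show "Q g e = 0" using F(5)[OF that] symmetric[of g e] by (auto simp: inner_commute)
    qed
    have "Q g h = S * inner g h" for h
    proof -
      \<comment> \<open>Stationarity tests only against vectors orthogonal to \<open>F\<close>.
        Subtracting the projection \<open>w\<close> of \<open>h\<close> brings \<open>h\<close> into
        that subspace, and both forms vanish between \<open>g\<close> and \<open>w\<close>.\<close>
      define w where "w = (\<Sum>e\<in>F. inner e h *\<^sub>R e)"
      have "inner e w = inner e h" if e: "e \<in> F" for e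
      proof -
        have "inner e w = (\<Sum>e'\<in>F. if e' = e then inner e h else 0)"
          unfolding w_def inner_sum_right
        proof (rule sum.cong)
          fix e' assume e': "e' \<in> F"
          show "inner e (inner e' h *\<^sub>R e') = (if e' = e then inner e h else 0)"
            using F(3) F(4)[OF e] e e' by (auto simp: pairwise_def orthogonal_def norm_eq_1)
        qed simp
        then show ?thesis using F(1) e by simp
      qed
      then have "h - w \<in> U" by (simp add: U_def inner_diff_right)
      then have "Q g (h - w) = S * inner g (h - w)"
        using constrained_maximizer_stationary[OF U g(1,2,4) max] by blast
      moreover have "Q g w = 0" "inner g w = 0"
        by (simp_all add: w_def Q.sum_right Q.scaleR_right inner_sum_right gF)
      ultimately show ?thesis by (simp add: Q.diff_right inner_diff_right)
    qed
    moreover have "g \<notin> F" using g(2) gF(1)[of g] by (auto simp: norm_eq_1)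
    moreover have "pairwise orthogonal (insert g F)"
      using F(3) gF(1) by (auto simp: pairwise_insert orthogonal_def inner_commute)
    ultimately show ?case
      using F g(2,3) by (intro exI[of _ "insert g F"]) auto
  qed
  then show ?thesis by blast
qed

end

section \<open>The Hilbert space \<open>H\<^sup>1\<^sub>0\<close>\<close>

text \<open>Riesz-Fischer, phrased with integrals of squares to match the norm of gradients. The
  last clause holds at every point and not just almost everywhere, since \<open>w\<close> is a
  pointwise \<open>lim\<close> along a subsequence; it keeps limits of gradients supported in
  [0,1].\<close>

lemma L2_complete:
  fixes u :: "nat \<Rightarrow> 'a \<Rightarrow> real"
  assumes meas [measurable]: "\<And>n. u n \<in> borel_measurable M"
    and int: "\<And>n. integrable M (\<lambda>x. (u n x)\<^sup>2)"
    and cauchy: "\<And>e. e > 0 \<Longrightarrow> \<exists>N. \<forall>m\<ge>N. \<forall>n\<ge>N. (LINT x|M. (u m x - u n x)\<^sup>2) < e"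
  obtains w where "w \<in> borel_measurable M" "integrable M (\<lambda>x. (w x)\<^sup>2)"
    "(\<lambda>n. LINT x|M. (u n x - w x)\<^sup>2) \<longlonglongrightarrow> 0"
    "\<And>x. (\<And>n. u n x = 0) \<Longrightarrow> w x = 0"
proof -
  have int_diff: "integrable M (\<lambda>x. (u m x - u n x)\<^sup>2)" for m n
  proof (rule Bochner_Integration.integrable_bound)
    show "integrable M (\<lambda>x. 2 * (u m x)\<^sup>2 + 2 * (u n x)\<^sup>2)" using int by simp
    show "AE x in M. norm ((u m x - u n x)\<^sup>2) \<le> norm (2 * (u m x)\<^sup>2 + 2 * (u n x)\<^sup>2)"
      using sum_squares_ge_zero by (intro AE_I2) (smt (verit) power2_diff power2_sum real_norm_def zero_le_power2)
  qed simp
  have nn: "(\<integral>\<^sup>+x. ennreal ((u m x - u n x)\<^sup>2) \<partial>M) = ennreal (LINT x|M. (u m x - u n x)\<^sup>2)" for m n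
    by (intro nn_integral_eq_integral int_diff) simp
  have "\<exists>N. \<forall>m\<ge>N. \<forall>n\<ge>N. (LINT x|M. (u m x - u n x)\<^sup>2) < 1 / 4 ^ j" for j :: nat
    by (rule cauchy) simp
  then obtain N where N: "\<And>j m n. N j \<le> m \<Longrightarrow> N j \<le> n \<Longrightarrow> (LINT x|M. (u m x - u n x)\<^sup>2) < 1 / 4 ^ j"
    by metis
  \<comment> \<open>The partial sums make the indices nondecreasing and at least \<open>N j\<close>;
    the summand \<open>j\<close> makes them tend to infinity.\<close>
  define k where "k j = (\<Sum>i\<le>j. N i) + j" for j
  have k: "N j \<le> k j" "j \<le> k j" "k j \<le> k (Suc j)" for j
    by (auto simp: k_def intro: trans_le_add1 member_le_sum)
  define v where "v j = u (k j)" for j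
  have [measurable]: "v j \<in> borel_measurable M" for j by (simp add: v_def)
  have "(\<integral>\<^sup>+x. (\<Sum>j. ennreal (2 ^ j * (v (Suc j) x - v j x)\<^sup>2)) \<partial>M)
      = (\<Sum>j. \<integral>\<^sup>+x. ennreal (2 ^ j * (v (Suc j) x - v j x)\<^sup>2) \<partial>M)"
    by (intro nn_integral_suminf) simp
  also have "\<dots> \<le> (\<Sum>j. ennreal ((1 / 2) ^ j))"
  proof (intro suminf_le)
    fix j
    have "(LINT x|M. (v (Suc j) x - v j x)\<^sup>2) \<le> 1 / 4 ^ j"
      unfolding v_def using k[of j] by (intro less_imp_le[OF N]) linarith+
    then have "2 ^ j * (LINT x|M. (v (Suc j) x - v j x)\<^sup>2) \<le> 2 ^ j * (1 / 4 ^ j)"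
      by (intro mult_left_mono) auto
    also have "\<dots> = (1 / 2) ^ j" by (simp add: field_simps flip: power_mult_distrib)
    finally have "(LINT x|M. 2 ^ j * (v (Suc j) x - v j x)\<^sup>2) \<le> (1 / 2) ^ j" by simp
    moreover have "(\<integral>\<^sup>+x. ennreal (2 ^ j * (v (Suc j) x - v j x)\<^sup>2) \<partial>M)
        = ennreal (LINT x|M. 2 ^ j * (v (Suc j) x - v j x)\<^sup>2)"
      using int_diff by (intro nn_integral_eq_integral) (auto simp: v_def)
    ultimately show "(\<integral>\<^sup>+x. ennreal (2 ^ j * (v (Suc j) x - v j x)\<^sup>2) \<partial>M) \<le> ennreal ((1 / 2) ^ j)"
      by (simp add: ennreal_leI)
  qed auto
  also have "\<dots> < \<infinity>"
    by (subst suminf_ennreal_eq[OF _ geometric_sums]) auto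
  finally have "AE x in M. (\<Sum>j. ennreal (2 ^ j * (v (Suc j) x - v j x)\<^sup>2)) \<noteq> \<infinity>"
    by (intro nn_integral_noteq_infinite) auto
  then have conv: "AE x in M. (\<lambda>j. v j x) \<longlonglongrightarrow> lim (\<lambda>j. v j x)"
  proof eventually_elim
    case (elim x)
    then have s: "summable (\<lambda>j. 2 ^ j * (v (Suc j) x - v j x)\<^sup>2)"
      by (intro summable_suminf_not_top) auto
    have "summable (\<lambda>j. v (Suc j) x - v j x)"
    proof (rule summable_comparison_test')
      show "summable (\<lambda>j. (1 / 2) ^ j + 2 ^ j * (v (Suc j) x - v j x)\<^sup>2)"
        by (intro summable_add s summable_geometric) simp
      fix j :: nat
      \<comment> \<open>The inequality t \<le> 2^-j + 2^j t^2 explains the weight 2^j in the series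
        above: the integrals, at most 2^j 4^-j, stay summable, and almost everywhere both terms on
        the right are summable.\<close>
      define t where "t = \<bar>v (Suc j) x - v j x\<bar>"
      define p :: real where "p = 2 ^ j"
      have p: "p > 0" by (simp add: p_def)
      have "0 \<le> (1 - p * t)\<^sup>2" by simp
      then have "2 * (p * t) \<le> 1 + p\<^sup>2 * t\<^sup>2" by (simp add: power2_eq_square algebra_simps)
      then have "2 * t \<le> 1 / p + p * t\<^sup>2" using p by (simp add: field_simps power2_eq_square)
      moreover have "t \<ge> 0" by (simp add: t_def)
      ultimately have "t \<le> 1 / p + p * t\<^sup>2" by linarith
      then show "norm (v (Suc j) x - v j x) \<le> (1 / 2) ^ j + 2 ^ j * (v (Suc j) x - v j x)\<^sup>2"
        by (simp add: t_def p_def power_one_over)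
    qed
    then have "convergent (\<lambda>n. \<Sum>j<n. v (Suc j) x - v j x)" by (simp add: summable_iff_convergent)
    then have "convergent (\<lambda>n. v n x - v 0 x)" by (simp only: sum_lessThan_telescope[of "\<lambda>j. v j x"])
    then have "convergent (\<lambda>n. (v n x - v 0 x) + v 0 x)"
      by (intro convergent_add convergent_const)
    then show ?case by (simp add: convergent_LIMSEQ_iff)
  qed
  define w where "w x = lim (\<lambda>j. v j x)" for x
  have w [measurable]: "w \<in> borel_measurable M" unfolding w_def by measurable
  \<comment> \<open>Comparing \<open>u n\<close> with the subsequence \<open>v j\<close> as
    \<open>j\<close> grows bounds the distance to the limit for every late \<open>n\<close>, so the
    full sequence converges.\<close>
  have fatou: "(\<integral>\<^sup>+x. ennreal ((u n x - w x)\<^sup>2) \<partial>M) \<le> ennreal e"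
    if e: "e > 0" and n: "\<And>m. m \<ge> n \<Longrightarrow> (LINT x|M. (u n x - u m x)\<^sup>2) < e" for n e
  proof -
    have "(\<integral>\<^sup>+x. ennreal ((u n x - w x)\<^sup>2) \<partial>M)
        = (\<integral>\<^sup>+x. liminf (\<lambda>j. ennreal ((u n x - v j x)\<^sup>2)) \<partial>M)"
    proof (rule nn_integral_cong_AE, use conv in eventually_elim)
      case (elim x)
      then have "(\<lambda>j. ennreal ((u n x - v j x)\<^sup>2)) \<longlonglongrightarrow> ennreal ((u n x - w x)\<^sup>2)"
        unfolding w_def by (intro tendsto_ennrealI tendsto_intros)
      then show ?case by (intro lim_imp_Liminf[symmetric]) auto
    qed
    also have "\<dots> \<le> liminf (\<lambda>j. \<integral>\<^sup>+x. ennreal ((u n x - v j x)\<^sup>2) \<partial>M)"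
      by (intro nn_integral_liminf) simp
    also have "\<dots> \<le> liminf (\<lambda>j. ennreal e)"
    proof (intro Liminf_mono)
      show "\<forall>\<^sub>F j in sequentially. (\<integral>\<^sup>+x. ennreal ((u n x - v j x)\<^sup>2) \<partial>M) \<le> ennreal e"
        using eventually_ge_at_top[of n]
      proof eventually_elim
        case (elim j)
        then have "n \<le> k j" using k(2)[of j] by linarith
        then show ?case unfolding v_def nn by (intro ennreal_leI less_imp_le[OF n])
      qed
    qed
    also have "\<dots> = ennreal e" by (simp add: Liminf_const)
    finally show ?thesis .
  qed
  have int_w: "integrable M (\<lambda>x. (u n x - w x)\<^sup>2) \<and> (LINT x|M. (u n x - w x)\<^sup>2) \<le> e"
    if e: "e > 0" and n: "\<And>m. m \<ge> n \<Longrightarrow> (LINT x|M. (u n x - u m x)\<^sup>2) < e" for n e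
  proof -
    note f = fatou[OF e n]
    have i: "integrable M (\<lambda>x. (u n x - w x)\<^sup>2)"
      using f by (intro integrableI_bounded) (auto simp: less_top[symmetric] top_unique neq_top_trans)
    have "(\<integral>\<^sup>+x. ennreal ((u n x - w x)\<^sup>2) \<partial>M) = ennreal (LINT x|M. (u n x - w x)\<^sup>2)"
      by (rule nn_integral_eq_integral[OF i]) simp
    then have "ennreal (LINT x|M. (u n x - w x)\<^sup>2) \<le> ennreal e"
      using f by simp
    then show ?thesis using i e by simp
  qed
  have lim0: "(\<lambda>n. LINT x|M. (u n x - w x)\<^sup>2) \<longlonglongrightarrow> 0"
  proof (rule LIMSEQ_I)
    fix e :: real assume e: "e > 0"
    then obtain N where N: "\<And>m n. m \<ge> N \<Longrightarrow> n \<ge> N \<Longrightarrow> (LINT x|M. (u m x - u n x)\<^sup>2) < e / 2"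
      using cauchy[of "e / 2"] by auto
    have "norm ((LINT x|M. (u n x - w x)\<^sup>2) - 0) < e" if "n \<ge> N" for n
    proof -
      have "(LINT x|M. (u n x - w x)\<^sup>2) \<le> e / 2"
        using int_w[of "e / 2" n] N that e by auto
      then show ?thesis using e by (simp add: integral_nonneg_AE)
    qed
    then show "\<exists>N. \<forall>n\<ge>N. norm ((LINT x|M. (u n x - w x)\<^sup>2) - 0) < e" by blast
  qed
  have "integrable M (\<lambda>x. (w x)\<^sup>2)"
  proof -
    obtain n where n: "\<And>m. m \<ge> n \<Longrightarrow> (LINT x|M. (u n x - u m x)\<^sup>2) < 1"
      using cauchy[of 1] by auto
    show ?thesis
    proof (rule Bochner_Integration.integrable_bound)
      show "integrable M (\<lambda>x. 2 * (u n x)\<^sup>2 + 2 * (u n x - w x)\<^sup>2)"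
        using int int_w[of 1 n] n by simp
      have "(w x)\<^sup>2 \<le> 2 * (u n x)\<^sup>2 + 2 * (u n x - w x)\<^sup>2" for x
        using zero_le_power2[of "2 * u n x - w x"] by (simp add: power2_eq_square algebra_simps)
      then show "AE x in M. norm ((w x)\<^sup>2) \<le> norm (2 * (u n x)\<^sup>2 + 2 * (u n x - w x)\<^sup>2)"
        by (intro AE_I2) simp
    qed simp
  qed
  moreover have "w x = 0" if "\<And>n. u n x = 0" for x
    unfolding w_def v_def that by simp
  ultimately show ?thesis using that[OF w _ lim0] by blast
qed

text \<open>Dynkin system argument: half-lines form an intersection-stable generator of the Borel
  sets, and the assumption on the total integral handles complements.\<close>

lemma AE_zero_of_integral_atMost_zero:
  fixes w :: "real \<Rightarrow> real"
  assumes int: "integrable lborel w" and total: "(LINT y|lborel. w y) = 0"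
    and zero: "\<And>x. (LINT y:{..x}|lborel. w y) = 0"
  shows "AE x in lborel. w x = 0"
proof (rule sigma_finite_measure.density_zero[OF sigma_finite_lborel int])
  have si: "set_integrable lborel A w" if "A \<in> sets borel" for A
    unfolding set_integrable_def using that int by (intro integrable_mult_indicator) auto
  fix A :: "real set" assume "A \<in> sets lborel"
  then have "A \<in> sigma_sets UNIV (range atMost)"
    by (simp add: borel_eq_atMost sets_measure_of)
  with _ _ show "(LINT y:A|lborel. w y) = 0"
  proof (rule sigma_sets_induct_disjoint)
    show "Int_stable (range atMost :: real set set)"
      by (auto simp: Int_stable_def)
  next
    fix A :: "real set" assume "A \<in> range atMost"
    then show "(LINT y:A|lborel. w y) = 0" using zero by auto
  next
    show "(LINT y:{}|lborel. w y) = 0" by (simp add: set_lebesgue_integral_def)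
  next
    fix A :: "real set"
    assume 1: "A \<in> sigma_sets UNIV (range atMost)" and 2: "(LINT y:A|lborel. w y) = 0"
    then have A: "A \<in> sets borel" by (simp add: borel_eq_atMost sets_measure_of)
    have "(LINT y:UNIV - A|lborel. w y) = (LINT y:UNIV|lborel. w y) - (LINT y:A|lborel. w y)"
      using set_integral_Un[of A "UNIV - A" lborel w] A si by (auto simp: Un_absorb1)
    then show "(LINT y:UNIV - A|lborel. w y) = 0"
      using 2 total by (simp add: set_lebesgue_integral_def)
  next
    fix A :: "nat \<Rightarrow> real set"
    assume d: "disjoint_family A" and r: "range A \<subseteq> sigma_sets UNIV (range atMost)"
      and z: "\<And>i. (LINT y:A i|lborel. w y) = 0"
    from r have A: "A i \<in> sets borel" for i by (auto simp: borel_eq_atMost sets_measure_of)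
    have "(LINT y:(\<Union>i. A i)|lborel. w y) = (\<Sum>i. LINT y:A i|lborel. w y)"
      using A d si by (intro lebesgue_integral_countable_add) (auto simp: disjoint_family_on_def)
    then show "(LINT y:(\<Union>i. A i)|lborel. w y) = 0" using z by simp
  qed auto
qed

section \<open>Functions of H^1_0 as primitives on the whole line\<close>

text \<open>The pair of a function in H^1_0 and its gradient, both extended by zero. The vanishing
  mean of \<open>u\<close> is the boundary condition at 1, and the support condition gives the one
  at 0. Integrals over the line replace set integrals throughout.\<close>

definition zero_primitive :: "(real \<Rightarrow> real) \<Rightarrow> (real \<Rightarrow> real) \<Rightarrow> bool" where
  "zero_primitive f u \<longleftrightarrow>
     u \<in> borel_measurable borel \<and> (\<forall>x. x \<notin> {0..1} \<longrightarrow> u x = 0) \<and>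
     integrable lborel (\<lambda>x. (u x)\<^sup>2) \<and> (LINT y|lborel. u y) = 0 \<and>
     (\<forall>x. f x = (LINT y|lborel. indicator {..x} y * u y))"

lemma integrable_unit_interval_square:
  fixes u :: "real \<Rightarrow> real"
  assumes "u \<in> borel_measurable borel" "\<And>x. x \<notin> {0..1} \<Longrightarrow> u x = 0"
    "integrable lborel (\<lambda>x. (u x)\<^sup>2)"
  shows "integrable lborel u"
proof (rule Bochner_Integration.integrable_bound)
  show "integrable lborel (\<lambda>x. indicator {0..1} x + (u x)\<^sup>2)"
    using assms by auto
  have "\<bar>t\<bar> \<le> 1 + t\<^sup>2" for t :: real
    using zero_le_power2[of "\<bar>t\<bar> - 1"] abs_ge_zero[of t]
    unfolding power2_diff by simp
  then have "\<bar>u x\<bar> \<le> indicator {0..1} x + (u x)\<^sup>2" for x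
    using assms(2)[of x] by (cases "x \<in> {0..1}") auto
  then show "AE x in lborel. norm (u x) \<le> norm (indicator {0..1} x + (u x)\<^sup>2)"
    by (intro AE_I2) (simp add: indicator_def)
qed (use assms in auto)

lemma zero_primitive_integrable:
  assumes "zero_primitive f u"
  shows "integrable lborel u"
  using assms by (auto simp: zero_primitive_def intro: integrable_unit_interval_square)

text \<open>Cauchy-Schwarz against the constant 1 on \<open>A\<close>, from the nonnegative integral
  of \<open>(h - m)^2\<close>; the best \<open>m\<close> is the mean of \<open>h\<close> over
  \<open>A\<close>, and a null set \<open>A\<close> is treated apart.\<close>

lemma square_integral_indicator_le:
  fixes h :: "'a \<Rightarrow> real"
  assumes A [measurable]: "A \<in> sets M" and fin: "emeasure M A \<noteq> \<infinity>"
    and h: "integrable M (\<lambda>t. indicator A t * h t)"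
    and h2: "integrable M (\<lambda>t. indicator A t * (h t)\<^sup>2)"
  shows "(LINT t|M. indicator A t * h t)\<^sup>2 \<le> measure M A * (LINT t|M. indicator A t * (h t)\<^sup>2)"
proof -
  define I where "I = (\<lambda>t. indicator A t :: real)"
  have I: "integrable M I" "(LINT t|M. I t) = measure M A"
    using fin by (auto simp: I_def less_top)
  define d where "d = (LINT t|M. I t * h t)"
  define S where "S = (LINT t|M. I t * (h t)\<^sup>2)"
  have quad: "2 * m * d \<le> S + m\<^sup>2 * measure M A" for m
  proof -
    have "0 \<le> (LINT t|M. I t * (h t - m)\<^sup>2)"
      by (intro integral_nonneg_AE) (auto simp: I_def)
    also have "\<dots> = (LINT t|M. I t * (h t)\<^sup>2 - 2 * m * (I t * h t) + m\<^sup>2 * I t)"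
      by (intro Bochner_Integration.integral_cong) (auto simp: power2_eq_square algebra_simps)
    also have "\<dots> = S - 2 * m * d + m\<^sup>2 * measure M A"
      using h h2 I by (simp add: S_def d_def I_def)
    finally show ?thesis by simp
  qed
  have "d\<^sup>2 \<le> measure M A * S"
  proof (cases "measure M A = 0")
    case True
    then have "emeasure M A = 0" using fin by (simp add: emeasure_eq_ennreal_measure)
    then have "AE t in M. I t * h t = 0"
      using AE_not_in[of A M] by (auto simp: I_def null_sets_def indicator_def)
    then show ?thesis using True by (simp add: d_def integral_eq_zero_AE)
  next
    case False
    then have "measure M A > 0" by (simp add: zero_less_measure_iff)
    then show ?thesis using quad[of "d / measure M A"] by (simp add: field_simps power2_eq_square)
  qed
  then show ?thesis by (simp add: d_def S_def I_def)
qed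

lemma integrable_indicator_times:
  fixes u :: "real \<Rightarrow> real"
  assumes "integrable lborel u" "A \<in> sets borel"
  shows "integrable lborel (\<lambda>y. indicator A y * u y)"
  using integrable_mult_indicator[OF _ assms(1), of A] assms(2) by simp

lemma zero_primitive_product_integrable:
  assumes "zero_primitive f u" "zero_primitive g v"
  shows "integrable lborel (\<lambda>x. u x * v x)"
proof (rule Bochner_Integration.integrable_bound)
  show "integrable lborel (\<lambda>x. (u x)\<^sup>2 + (v x)\<^sup>2)"
    using assms by (auto simp: zero_primitive_def)
  have "\<bar>s * t\<bar> \<le> s\<^sup>2 + t\<^sup>2" for s t :: real
    using sum_squares_bound[of "\<bar>s\<bar>" "\<bar>t\<bar>"] abs_ge_zero[of "s * t"]
    unfolding abs_mult power2_abs by linarith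
  then show "AE x in lborel. norm (u x * v x) \<le> norm ((u x)\<^sup>2 + (v x)\<^sup>2)"
    by (intro AE_I2) simp
qed (use assms in \<open>auto simp: zero_primitive_def\<close>)

lemma zero_primitive_add:
  assumes "zero_primitive f u" "zero_primitive g v"
  shows "zero_primitive (\<lambda>x. f x + g x) (\<lambda>x. u x + v x)"
proof -
  note i = zero_primitive_integrable[OF assms(1)] zero_primitive_integrable[OF assms(2)]
  have "integrable lborel (\<lambda>x. (u x)\<^sup>2 + (v x)\<^sup>2 + 2 * (u x * v x))"
    using zero_primitive_product_integrable[OF assms] assms
    by (auto simp: zero_primitive_def)
  then have "integrable lborel (\<lambda>x. (u x + v x)\<^sup>2)"
    by (simp add: power2_sum mult.assoc)
  then show ?thesis
    using assms i integrable_indicator_times[OF i(1)] integrable_indicator_times[OF i(2)]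
    by (auto simp: zero_primitive_def distrib_left)
qed

lemma zero_primitive_scale:
  assumes "zero_primitive f u"
  shows "zero_primitive (\<lambda>x. r * f x) (\<lambda>x. r * u x)"
  using assms by (auto simp: zero_primitive_def power_mult_distrib mult.left_commute)

text \<open>Makes gradients picked by \<open>SOME\<close> harmless: any two choices agree almost
  everywhere.\<close>

lemma zero_primitive_unique:
  assumes "zero_primitive f u" "zero_primitive f v"
  shows "AE x in lborel. u x = v x"
proof -
  note i = zero_primitive_integrable[OF assms(1)] zero_primitive_integrable[OF assms(2)]
  have "AE x in lborel. u x - v x = 0"
  proof (rule AE_zero_of_integral_atMost_zero)
    show "(LINT y:{..x}|lborel. u y - v y) = 0" for x
      using assms integrable_indicator_times[OF i(1)] integrable_indicator_times[OF i(2)]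
      by (simp add: zero_primitive_def set_lebesgue_integral_def right_diff_distrib)
  qed (use assms i in \<open>auto simp: zero_primitive_def\<close>)
  then show ?thesis by simp
qed

lemma zero_primitive_outside:
  assumes "zero_primitive f u"
  shows "x \<le> 0 \<Longrightarrow> f x = 0" "1 \<le> x \<Longrightarrow> f x = 0"
proof -
  show "f x = 0" if "x \<le> 0"
  proof -
    have "AE y in lborel. y \<noteq> (0::real)" by (rule AE_lborel_singleton)
    then have "AE y in lborel. indicator {..x} y * u y = 0"
      by eventually_elim (use assms that in \<open>auto simp: zero_primitive_def indicator_def\<close>)
    then show ?thesis using assms by (simp add: zero_primitive_def integral_eq_zero_AE)
  qed
  show "f x = 0" if "1 \<le> x"
  proof -
    have "(\<lambda>y. indicator {..x} y * u y) = u"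
      using assms that by (auto simp: zero_primitive_def indicator_def fun_eq_iff)
    then show ?thesis using assms by (simp add: zero_primitive_def)
  qed
qed

lemma H10_gradient_zero_primitive:
  assumes f: "f \<in> H10" and g: "is_gradient f g"
  shows "zero_primitive f (\<lambda>x. indicator {0..1} x * g x)"
proof -
  define u where "u = (\<lambda>x. indicator {0..1} x * g x)"
  have meas: "u \<in> borel_measurable borel"
    using g by (simp add: is_gradient_def set_borel_measurable_def u_def)
  have "(u x)\<^sup>2 = indicator {0..1} x * (g x)\<^sup>2" for x by (auto simp: u_def indicator_def)
  then have sq: "integrable lborel (\<lambda>x. (u x)\<^sup>2)"
    using g by (simp add: is_gradient_def set_integrable_def)
  have eq: "f x = (LINT y|lborel. indicator {..x} y * u y)" if "x \<in> {0..1}" for x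
  proof -
    have "f x = (LINT y|lborel. indicator {0..x} y * g y)"
      using g that by (simp add: is_gradient_def set_lebesgue_integral_def)
    also have "\<dots> = (LINT y|lborel. indicator {..x} y * u y)"
      by (intro Bochner_Integration.integral_cong) (use that in \<open>auto simp: u_def indicator_def\<close>)
    finally show ?thesis .
  qed
  have one: "(\<lambda>y. indicator {..x} y * u y) = u" if "x \<ge> 1" for x
    using that by (auto simp: u_def indicator_def fun_eq_iff)
  have total: "(LINT y|lborel. u y) = 0"
    using eq[of 1] f by (simp add: one H10_def)
  have "f x = (LINT y|lborel. indicator {..x} y * u y)" for x
  proof -
    consider "x \<in> {0..1}" | "x < 0" | "x > 1" by force
    then show ?thesis
    proof cases
      case 2
      then have "(\<lambda>y. indicator {..x} y * u y) = (\<lambda>_. 0)"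
        by (auto simp: u_def indicator_def fun_eq_iff)
      then show ?thesis using 2 f by (simp add: H10_def)
    next
      case 3
      then show ?thesis using f total by (simp add: one H10_def)
    qed (rule eq)
  qed
  then show ?thesis
    using meas sq total by (auto simp: zero_primitive_def u_def)
qed

lemma zero_primitive_is_gradient:
  assumes "zero_primitive f u"
  shows "is_gradient f u"
proof -
  have "(\<lambda>x. indicator {0..1} x * u x) = u" "(\<lambda>x. indicator {0..1} x * (u x)\<^sup>2) = (\<lambda>x. (u x)\<^sup>2)"
    using assms by (auto simp: zero_primitive_def indicator_def fun_eq_iff)
  moreover have "(\<lambda>y. indicator {0..x} y * u y) = (\<lambda>y. indicator {..x} y * u y)" for x
    using assms by (auto simp: zero_primitive_def indicator_def fun_eq_iff)
  ultimately show ?thesis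
    using assms by (simp add: is_gradient_def zero_primitive_def set_borel_measurable_def
      set_integrable_def set_lebesgue_integral_def)
qed

lemma zero_primitive_H10: "zero_primitive f u \<Longrightarrow> f \<in> H10"
  using zero_primitive_is_gradient[of f u] zero_primitive_outside[of f u]
  by (force simp: H10_def)

lemma H10_iff: "f \<in> H10 \<longleftrightarrow> (\<exists>u. zero_primitive f u)"
proof
  assume f: "f \<in> H10"
  then obtain g where "is_gradient f g" by (auto simp: H10_def)
  with f show "\<exists>u. zero_primitive f u" by (blast intro: H10_gradient_zero_primitive)
qed (blast intro: zero_primitive_H10)

text \<open>The choice made in \<open>gradient\<close> and the passage from (0,1) to the whole line
  affect the integrand only on a null set.\<close>

lemma energy_form_eq:
  assumes u: "zero_primitive f u" and v: "zero_primitive g v"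
  shows "energy_form f g = (LINT x|lborel. u x * v x)"
proof -
  define D where "D f = (\<lambda>x. indicator {0..1} x * gradient f x)" for f
  have D: "zero_primitive f (D f)" if "zero_primitive f u" for f u
  proof -
    have "is_gradient f (gradient f)"
      unfolding gradient_def using zero_primitive_is_gradient[OF that] by (rule someI[of "is_gradient f"])
    then show ?thesis
      unfolding D_def by (rule H10_gradient_zero_primitive[OF zero_primitive_H10[OF that]])
  qed
  have [measurable]: "D f \<in> borel_measurable borel" "D g \<in> borel_measurable borel"
    "u \<in> borel_measurable borel" "v \<in> borel_measurable borel"
    using D[OF u] D[OF v] u v by (auto simp: zero_primitive_def)
  have "energy_form f g = (LINT x|lborel. indicator {0<..<1} x * (D f x * D g x))"
    unfolding energy_form_def set_lebesgue_integral_def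
    by (intro Bochner_Integration.integral_cong) (auto simp: D_def indicator_def)
  also have "\<dots> = (LINT x|lborel. u x * v x)"
  proof (rule integral_cong_AE)
    have "AE x in lborel. x \<noteq> (0::real)" "AE x in lborel. x \<noteq> (1::real)"
      by (rule AE_lborel_singleton)+
    then show "AE x in lborel. indicator {0<..<1} x * (D f x * D g x) = u x * v x"
      using zero_primitive_unique[OF D[OF u] u] zero_primitive_unique[OF D[OF v] v]
    proof eventually_elim
      case (elim x)
      show ?case
      proof (cases "x \<in> {0<..<1}")
        case False
        then have "x \<notin> {0..1}" using elim by auto
        then show ?thesis using u False by (simp add: zero_primitive_def)
      qed (use elim in simp)
    qed
  qed measurable
  finally show ?thesis .
qed

section \<open>The Hilbert space with the energy as inner product\<close>

typedef h10 = H10 morphisms fun_of Abs_h10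
proof -
  have "zero_primitive (\<lambda>_. 0) (\<lambda>_. 0)" by (auto simp: zero_primitive_def)
  then show ?thesis by (blast intro: zero_primitive_H10)
qed

setup_lifting type_definition_h10

instantiation h10 :: real_vector
begin

lift_definition zero_h10 :: h10 is "\<lambda>_. 0"
  using zero_primitive_H10[of "\<lambda>_. 0" "\<lambda>_. 0"] by (auto simp: zero_primitive_def)

lift_definition plus_h10 :: "h10 \<Rightarrow> h10 \<Rightarrow> h10" is "\<lambda>f g x. f x + g x"
  by (auto simp: H10_iff intro: zero_primitive_add)

lift_definition scaleR_h10 :: "real \<Rightarrow> h10 \<Rightarrow> h10" is "\<lambda>r f x. r * f x"
  by (auto simp: H10_iff intro: zero_primitive_scale)

lift_definition uminus_h10 :: "h10 \<Rightarrow> h10" is "\<lambda>f x. - f x"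
  using zero_primitive_scale[of _ _ "-1"] by (auto simp: H10_iff)

definition minus_h10 :: "h10 \<Rightarrow> h10 \<Rightarrow> h10" where "f - g = f + - (g :: h10)"

instance
  by standard (unfold minus_h10_def, (transfer, simp add: fun_eq_iff algebra_simps)+)

end

lemma fun_of_simps [simp]:
  "fun_of 0 x = 0" "fun_of (f + g) x = fun_of f x + fun_of g x"
  "fun_of (r *\<^sub>R f) x = r * fun_of f x" "fun_of (- f) x = - fun_of f x"
  "fun_of (f - g) x = fun_of f x - fun_of g x"
  unfolding minus_h10_def by (transfer, simp)+

lemma fun_of_sum [simp]: "fun_of (sum h A) x = (\<Sum>a\<in>A. fun_of (h a) x)"
  by (induction A rule: infinite_finite_induct) auto

text \<open>In contrast to \<open>gradient\<close>, this representative is Borel on the line and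
  zero outside [0,1]. It is linear in \<open>f\<close> only up to null sets.\<close>

definition grad :: "h10 \<Rightarrow> real \<Rightarrow> real" where
  "grad f = (SOME u. zero_primitive (fun_of f) u)"

lemma grad: "zero_primitive (fun_of f) (grad f)"
  using fun_of[of f] unfolding H10_iff grad_def by (rule someI_ex)

lemma fun_of_eq_integral: "fun_of f x = (LINT y|lborel. indicator {..x} y * grad f y)"
  using grad[of f] by (simp add: zero_primitive_def)

lemma grad_measurable [measurable]: "grad f \<in> borel_measurable borel"
  using grad[of f] by (simp add: zero_primitive_def)

lemma grad_outside: "x \<notin> {0..1} \<Longrightarrow> grad f x = 0"
  using grad[of f] by (simp add: zero_primitive_def)

lemma integrable_grad: "integrable lborel (grad f)"
  using zero_primitive_integrable[OF grad] .

lemma integrable_grad_mult: "integrable lborel (\<lambda>x. grad f x * grad g x)"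
  using zero_primitive_product_integrable[OF grad grad] .

lemma integrable_grad_square: "integrable lborel (\<lambda>x. (grad f x)\<^sup>2)"
  using grad[of f] by (simp add: zero_primitive_def)

lemma grad_add: "AE x in lborel. grad (f + g) x = grad f x + grad g x"
  using zero_primitive_unique[OF grad[of "f + g", unfolded plus_h10.rep_eq] zero_primitive_add[OF grad grad]] .

lemma grad_scaleR: "AE x in lborel. grad (r *\<^sub>R f) x = r * grad f x"
  using zero_primitive_unique[OF grad[of "r *\<^sub>R f", unfolded scaleR_h10.rep_eq] zero_primitive_scale[OF grad]] .

instantiation h10 :: real_inner
begin

definition inner_h10 :: "h10 \<Rightarrow> h10 \<Rightarrow> real" where
  "inner f g = energy_form (fun_of f) (fun_of g)"

definition norm_h10 :: "h10 \<Rightarrow> real" where "norm (f :: h10) = sqrt (inner f f)"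

definition sgn_h10 :: "h10 \<Rightarrow> h10" where "sgn (f :: h10) = inverse (norm f) *\<^sub>R f"

definition dist_h10 :: "h10 \<Rightarrow> h10 \<Rightarrow> real" where "dist (f :: h10) g = norm (f - g)"

definition uniformity_h10 :: "(h10 \<times> h10) filter" where
  "uniformity_h10 = (INF e\<in>{0<..}. principal {(x, y). dist x y < e})"

definition open_h10 :: "h10 set \<Rightarrow> bool" where
  "open_h10 U \<longleftrightarrow> (\<forall>x\<in>U. \<forall>\<^sub>F (x', y) in uniformity. x' = x \<longrightarrow> y \<in> U)"

lemma inner_h10_eq: "inner f g = (LINT x|lborel. grad f x * grad g x)" for f g :: h10
  unfolding inner_h10_def by (rule energy_form_eq[OF grad grad])

instance
proof
  fix x y z :: h10 and r :: real
  show "inner x y = inner y x" by (simp add: inner_h10_eq mult.commute)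
  have "inner (x + y) z = (LINT t|lborel. grad x t * grad z t + grad y t * grad z t)"
    unfolding inner_h10_eq
    by (rule integral_cong_AE) (use grad_add[of x y] in \<open>auto simp: algebra_simps\<close>)
  then show "inner (x + y) z = inner x z + inner y z"
    by (simp add: inner_h10_eq integrable_grad_mult)
  have "inner (r *\<^sub>R x) y = (LINT t|lborel. r * (grad x t * grad y t))"
    unfolding inner_h10_eq
    by (rule integral_cong_AE) (use grad_scaleR[of r x] in \<open>auto simp: algebra_simps\<close>)
  then show "inner (r *\<^sub>R x) y = r * inner x y"
    by (simp add: inner_h10_eq)
  show "0 \<le> inner x x" by (simp add: inner_h10_eq)
  \<comment> \<open>The energy alone is definite: a function in H^1_0 is the primitive of its
    gradient and vanishes if the gradient does almost everywhere.\<close>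
  show "inner x x = 0 \<longleftrightarrow> x = 0"
  proof
    assume "inner x x = 0"
    then have "AE t in lborel. grad x t * grad x t = 0"
      unfolding inner_h10_eq using integrable_grad_mult[of x x]
      by (subst (asm) integral_nonneg_eq_0_iff_AE) auto
    then have "AE t in lborel. grad x t = 0" by simp
    then have "AE t in lborel. indicator {..s} t * grad x t = 0" for s
      by eventually_elim simp
    then have "fun_of x s = 0" for s
      unfolding fun_of_eq_integral by (rule integral_eq_zero_AE)
    then show "x = 0" by (simp add: fun_of_inject[symmetric] fun_eq_iff)
  next
    assume "x = 0"
    have "AE t in lborel. grad (0 *\<^sub>R x) t = 0 * grad x t" by (rule grad_scaleR)
    then have "AE t in lborel. grad x t * grad x t = 0" using \<open>x = 0\<close> by simp
    then show "inner x x = 0" unfolding inner_h10_eq by (rule integral_eq_zero_AE)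
  qed
qed (auto simp: norm_h10_def sgn_h10_def dist_h10_def uniformity_h10_def open_h10_def)

end

lemma norm_h10_square: "(norm f)\<^sup>2 = (LINT x|lborel. (grad f x)\<^sup>2)" for f :: h10
  unfolding power2_norm_eq_inner inner_h10_eq by (simp add: power2_eq_square)

lemma grad_diff: "AE x in lborel. grad (f - g) x = grad f x - grad g x"
  using grad_add[of f "(-1) *\<^sub>R g"] grad_scaleR[of "-1" g] by eventually_elim simp

lemma fun_of_outside: "x \<le> 0 \<Longrightarrow> fun_of f x = 0" "1 \<le> x \<Longrightarrow> fun_of f x = 0"
  using zero_primitive_outside[OF grad] by auto

text \<open>The energy is kept local to the interval, because in the upper bound for the eigenvalue
  count the energies of disjoint pieces must add up to at most the full energy.\<close>

lemma fun_of_increment_local: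
  assumes "x \<le> y"
  shows "(fun_of f y - fun_of f x)\<^sup>2 \<le> (y - x) * (LINT t|lborel. indicator {x<..y} t * (grad f t)\<^sup>2)"
proof -
  have i: "integrable lborel (\<lambda>t. indicator A t * grad f t)" if "A \<in> sets borel" for A
    by (rule integrable_indicator_times[OF integrable_grad that])
  have "fun_of f y - fun_of f x
      = (LINT t|lborel. indicator {..y} t * grad f t - indicator {..x} t * grad f t)"
    unfolding fun_of_eq_integral by (intro Bochner_Integration.integral_diff[symmetric] i) auto
  also have "\<dots> = (LINT t|lborel. indicator {x<..y} t * grad f t)"
    by (intro Bochner_Integration.integral_cong) (use assms in \<open>auto simp: indicator_def\<close>)
  finally show ?thesis
    using square_integral_indicator_le[of "{x<..y}" lborel "grad f"] assms i
      integrable_indicator_times[OF integrable_grad_square, of "{x<..y}" f]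
    by simp
qed

lemma integral_indicator_grad_le: "(LINT t|lborel. indicator A t * (grad f t)\<^sup>2) \<le> (norm f)\<^sup>2"
  if "A \<in> sets borel"
  unfolding norm_h10_square
  by (intro integral_mono integrable_indicator_times integrable_grad_square that)
    (auto simp: indicator_def)

lemma fun_of_increment: "(fun_of f y - fun_of f x)\<^sup>2 \<le> \<bar>y - x\<bar> * (norm f)\<^sup>2"
proof -
  have *: "(fun_of f y - fun_of f x)\<^sup>2 \<le> (y - x) * (norm f)\<^sup>2" if "x \<le> y" for x y
    by (rule order_trans[OF fun_of_increment_local[OF that]])
      (intro mult_left_mono integral_indicator_grad_le, use that in auto)
  show ?thesis
    using *[of x y] *[of y x] by (cases "x \<le> y") (auto simp: power2_commute)
qed

lemma abs_fun_of_increment: "\<bar>fun_of f y - fun_of f x\<bar> \<le> sqrt \<bar>y - x\<bar> * norm f"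
proof -
  have "\<bar>fun_of f y - fun_of f x\<bar> \<le> sqrt (\<bar>y - x\<bar> * (norm f)\<^sup>2)"
    using fun_of_increment[of f y x] by (intro real_le_rsqrt) simp
  then show ?thesis by (simp add: real_sqrt_mult)
qed

lemma abs_fun_of_le: "\<bar>fun_of f x\<bar> \<le> norm f"
proof (cases "x \<in> {0..1}")
  case True
  have "\<bar>fun_of f x\<bar> \<le> sqrt \<bar>x\<bar> * norm f"
    using abs_fun_of_increment[of f x 0] by (simp add: fun_of_outside)
  also have "\<dots> \<le> 1 * norm f" using True by (intro mult_right_mono) auto
  finally show ?thesis by simp
qed (use fun_of_outside[of x f] in \<open>auto simp: not_le\<close>)

lemma continuous_fun_of: "continuous_on A (fun_of f)"
proof -
  have "isCont (fun_of f) x" for x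
  proof -
    have "(\<lambda>y. sqrt \<bar>y - x\<bar> * norm f) \<midarrow>x\<rightarrow> 0"
      by (rule tendsto_eq_intros refl)+ simp
    then have "(\<lambda>y. fun_of f y - fun_of f x) \<midarrow>x\<rightarrow> 0"
      by (rule Lim_null_comparison[OF always_eventually, rotated]) (simp add: abs_fun_of_increment)
    then show ?thesis by (simp add: isCont_def LIM_zero_iff)
  qed
  then show ?thesis by (simp add: continuous_at_imp_continuous_on)
qed

text \<open>The gradients converge in L^2. Their limit \<open>w\<close> is again a gradient of an
  element of H^1_0 because the support in [0,1] and the zero mean survive the limit; the mean is
  controlled by Cauchy-Schwarz on [0,1].\<close>

instance h10 :: complete_space
proof
  fix X :: "nat \<Rightarrow> h10"
  assume X: "Cauchy X"
  have norm_diff: "(norm (f - g))\<^sup>2 = (LINT x|lborel. (grad f x - grad g x)\<^sup>2)" for f g :: h10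
    unfolding norm_h10_square
    by (rule integral_cong_AE) (use grad_diff[of f g] in auto)
  obtain w where w: "w \<in> borel_measurable lborel" "integrable lborel (\<lambda>x. (w x)\<^sup>2)"
    and lim: "(\<lambda>n. LINT x|lborel. (grad (X n) x - w x)\<^sup>2) \<longlonglongrightarrow> 0"
    and zero: "\<And>x. (\<And>n. grad (X n) x = 0) \<Longrightarrow> w x = 0"
  proof (rule L2_complete[of "\<lambda>n. grad (X n)" lborel])
    fix e :: real assume "e > 0"
    then obtain N where "\<And>m n. m \<ge> N \<Longrightarrow> n \<ge> N \<Longrightarrow> norm (X m - X n) < sqrt e"
      using CauchyD[OF X, of "sqrt e"] by auto
    then have "\<And>m n. m \<ge> N \<Longrightarrow> n \<ge> N \<Longrightarrow> (norm (X m - X n))\<^sup>2 < e"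
      using \<open>e > 0\<close> by (metis norm_ge_zero power_strict_mono real_sqrt_pow2 less_imp_le zero_less_numeral)
    then show "\<exists>N. \<forall>m\<ge>N. \<forall>n\<ge>N. (LINT x|lborel. (grad (X m) x - grad (X n) x)\<^sup>2) < e"
      unfolding norm_diff by blast
  qed (auto simp: integrable_grad_square)
  have out: "w x = 0" if "x \<notin> {0..1}" for x
    using that by (intro zero grad_outside)
  have int_w: "integrable lborel w"
    by (rule integrable_unit_interval_square) (use w out in simp_all)
  have "(LINT x|lborel. w x)\<^sup>2 \<le> (LINT x|lborel. (grad (X n) x - w x)\<^sup>2)" for n
  proof -
    have ind: "(\<lambda>x. indicator {0..1} x * (grad (X n) x - w x)) = (\<lambda>x. grad (X n) x - w x)"
      "(\<lambda>x. indicator {0..1} x * (grad (X n) x - w x)\<^sup>2) = (\<lambda>x. (grad (X n) x - w x)\<^sup>2)"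
      by (rule ext, case_tac "x \<in> {0..1}", simp_all add: out grad_outside)+
    have "integrable lborel (\<lambda>x. 2 * (grad (X n) x)\<^sup>2 + 2 * (w x)\<^sup>2)"
      using w integrable_grad_square by simp
    then have "integrable lborel (\<lambda>x. (grad (X n) x - w x)\<^sup>2)"
    proof (rule Bochner_Integration.integrable_bound)
      have "(s - t)\<^sup>2 \<le> 2 * s\<^sup>2 + 2 * t\<^sup>2" for s t :: real
        using zero_le_power2[of "s + t"] by (simp add: power2_eq_square algebra_simps)
      then show "AE x in lborel. norm ((grad (X n) x - w x)\<^sup>2) \<le> norm (2 * (grad (X n) x)\<^sup>2 + 2 * (w x)\<^sup>2)"
        by (intro AE_I2) simp
    qed (use w in measurable)
    then have "(LINT x|lborel. grad (X n) x - w x)\<^sup>2 \<le> (LINT x|lborel. (grad (X n) x - w x)\<^sup>2)"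
      using square_integral_indicator_le[of "{0..1}" lborel "\<lambda>x. grad (X n) x - w x"]
        integrable_grad[of "X n"] int_w unfolding ind by simp
    moreover have "(LINT x|lborel. grad (X n) x - w x) = - (LINT x|lborel. w x)"
      using grad[of "X n"] integrable_grad[of "X n"] int_w by (simp add: zero_primitive_def)
    ultimately show ?thesis by simp
  qed
  then have "(LINT x|lborel. w x)\<^sup>2 \<le> 0"
    by (intro tendsto_lowerbound[OF lim]) auto
  then have "(LINT x|lborel. w x) = 0" by simp
  then have "zero_primitive (\<lambda>x. LINT y|lborel. indicator {..x} y * w y) w"
    using w out by (simp add: zero_primitive_def)
  then obtain f where f: "zero_primitive (fun_of f) w"
    using zero_primitive_H10 fun_of_cases by metis
  have "(norm (X n - f))\<^sup>2 = (LINT x|lborel. (grad (X n) x - w x)\<^sup>2)" for n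
    unfolding norm_diff
    by (rule integral_cong_AE) (use zero_primitive_unique[OF grad f] w in auto)
  then have "(\<lambda>n. (norm (X n - f))\<^sup>2) \<longlonglongrightarrow> 0" using lim by simp
  then have "(\<lambda>n. sqrt ((norm (X n - f))\<^sup>2)) \<longlonglongrightarrow> sqrt 0" by (rule tendsto_real_sqrt)
  then have "(\<lambda>n. X n - f) \<longlonglongrightarrow> 0" by (simp add: tendsto_norm_zero_iff)
  then show "convergent X" unfolding convergent_def using LIM_zero_iff by blast
qed

section \<open>Upper bound for the eigenvalue count\<close>

text \<open>Multiplicities are defined in the vector space of all functions, the Hilbert space
  argument lives in \<open>h10\<close>; dimensions agree since \<open>fun_of\<close> is linear and
  injective.\<close>

lemma dim_fun_of_image:
  "vector_space.dim (\<lambda>(c::real) (f::real \<Rightarrow> real). \<lambda>x. c * f x) (fun_of ` S) = dim S"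
proof -
  interpret fs: vector_space "\<lambda>(c::real) (f::real \<Rightarrow> real). \<lambda>x. c * f x"
    by unfold_locales (auto simp: fun_eq_iff algebra_simps)
  interpret L: Vector_Spaces.linear "(*\<^sub>R) :: real \<Rightarrow> h10 \<Rightarrow> h10" "\<lambda>(c::real) (f::real \<Rightarrow> real). \<lambda>x. c * f x" fun_of
    by unfold_locales (auto simp: fun_eq_iff)
  obtain B where B: "B \<subseteq> S" "independent B" "S \<subseteq> span B" "card B = dim S"
    using basis_exists[of S] by blast
  have inj: "inj_on fun_of A" for A by (auto simp: inj_on_def fun_of_inject)
  have "fs.independent (fun_of ` B)"
    using L.independent_injective_image[OF _ inj] B(2) unfolding dependent_raw_def by blast
  moreover have "fun_of ` S \<subseteq> fs.span (fun_of ` B)"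
    using B(3) L.span_image[of B] unfolding span_raw_def by auto
  ultimately have "card (fun_of ` B) = fs.dim (fun_of ` S)"
    using B(1) by (intro fs.basis_card_eq_dim) auto
  then show ?thesis using B(4) by (simp add: card_image[OF inj])
qed

context measure_01
begin

section \<open>The \<open>\<nu>\<close>-form and its compactness\<close>

definition mass :: real where "mass = measure \<nu> UNIV"

lemma mass_nonneg: "mass \<ge> 0" by (simp add: mass_def)

definition prod_form :: "h10 \<Rightarrow> h10 \<Rightarrow> real" where
  "prod_form f g = (LINT x|\<nu>. fun_of f x * fun_of g x)"

lemma fun_of_measurable [measurable]: "fun_of f \<in> borel_measurable borel"
  using continuous_fun_of by (rule borel_measurable_continuous_onI)

lemma integrable_prod: "integrable \<nu> (\<lambda>x. fun_of f x * fun_of g x)"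
proof (rule integrable_const_bound[where B = "norm f * norm g"])
  show "AE x in \<nu>. norm (fun_of f x * fun_of g x) \<le> norm f * norm g"
    by (intro AE_I2) (auto simp: abs_mult intro!: mult_mono abs_fun_of_le)
qed measurable

lemma abs_prod_form_le: "\<bar>prod_form f g\<bar> \<le> norm f * norm g * mass"
proof -
  have "\<bar>prod_form f g\<bar> \<le> (LINT x|\<nu>. \<bar>fun_of f x * fun_of g x\<bar>)"
    unfolding prod_form_def by (rule integral_abs_bound)
  also have "\<dots> \<le> (LINT x|\<nu>. norm f * norm g)"
  proof (intro integral_mono)
    show "integrable \<nu> (\<lambda>x. \<bar>fun_of f x * fun_of g x\<bar>)"
      by (intro integrable_abs integrable_prod)
    show "\<bar>fun_of f x * fun_of g x\<bar> \<le> norm f * norm g" for x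
      unfolding abs_mult by (intro mult_mono abs_fun_of_le) auto
  qed simp
  also have "\<dots> = norm f * norm g * mass" by (simp add: mass_def mult.commute)
  finally show ?thesis .
qed

lemma bounded_bilinear_prod_form: "bounded_bilinear prod_form"
proof
  show "\<exists>K. \<forall>f g. norm (prod_form f g) \<le> norm f * norm g * K"
    using abs_prod_form_le by auto
qed (auto simp: prod_form_def distrib_left distrib_right integrable_prod mult.assoc mult.left_commute)

lemma prod_form_nonneg: "prod_form f f \<ge> 0"
  by (simp add: prod_form_def)

text \<open>The unit ball is uniformly bounded and uniformly 1/2-Hoelder, so Arzela-Ascoli gives
  uniformly convergent subsequences; since \<open>\<nu>\<close> is finite, uniform closeness makes
  the \<open>\<nu>\<close>-form of differences small.\<close>

lemma prod_form_compact:
  assumes X: "\<And>n. norm (X n :: h10) \<le> 1"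
  shows "\<exists>k :: nat \<Rightarrow> nat. strict_mono k \<and>
    (\<forall>e>0. \<exists>N. \<forall>m\<ge>N. \<forall>n\<ge>N. prod_form (X (k m) - X (k n)) (X (k m) - X (k n)) < e)"
proof -
  obtain g k where k: "strict_mono (k :: nat \<Rightarrow> nat)"
    and conv: "\<And>e. 0 < e \<Longrightarrow> \<exists>N. \<forall>n x. n \<ge> N \<and> x \<in> {0..1} \<longrightarrow> norm (fun_of (X (k n)) x - g x) < e"
  proof (rule Arzela_Ascoli[of "{0..1::real}" "\<lambda>n. fun_of (X n)" 1])
    show "norm (fun_of (X n) x) \<le> 1" for n x
      using order_trans[OF abs_fun_of_le X] by simp
    show "\<exists>d>0. \<forall>n y. y \<in> {0..1} \<and> norm (x - y) < d \<longrightarrow> norm (fun_of (X n) x - fun_of (X n) y) < e"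
      if "0 < e" for x e :: real
    proof (intro exI[of _ "e\<^sup>2"] conjI allI impI)
      fix n y assume *: "y \<in> {0..1} \<and> norm (x - y) < e\<^sup>2"
      have "\<bar>fun_of (X n) x - fun_of (X n) y\<bar> \<le> sqrt \<bar>x - y\<bar> * norm (X n)"
        by (rule abs_fun_of_increment)
      also have "\<dots> \<le> sqrt \<bar>x - y\<bar> * 1" by (intro mult_left_mono X) simp
      also have "\<dots> < e" using * that by (simp add: real_less_lsqrt)
      finally show "norm (fun_of (X n) x - fun_of (X n) y) < e" by simp
    qed (use that in simp)
  qed auto
  have "\<exists>N. \<forall>m\<ge>N. \<forall>n\<ge>N. prod_form (X (k m) - X (k n)) (X (k m) - X (k n)) < e" if e: "e > 0" for e
  proof -
    \<comment> \<open>Differences are at most 2 d, so the form is at most 4 d^2 times the mass. The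
      summand 1 gives a strict inequality even for mass 0.\<close>
    define d where "d = sqrt (e / (4 * (mass + 1)))"
    have d: "d > 0" "4 * d\<^sup>2 * (mass + 1) = e"
      using e mass_nonneg by (auto simp: d_def field_simps)
    obtain N where N: "\<And>n x. n \<ge> N \<Longrightarrow> x \<in> {0..1} \<Longrightarrow> \<bar>fun_of (X (k n)) x - g x\<bar> < d"
      using conv[OF d(1)] by auto
    have "prod_form (X (k m) - X (k n)) (X (k m) - X (k n)) < e" if mn: "m \<ge> N" "n \<ge> N" for m n
    proof -
      let ?f = "X (k m) - X (k n)"
      have le: "\<bar>fun_of ?f x\<bar> \<le> 2 * d" for x
      proof (cases "x \<in> {0..1}")
        case True
        then show ?thesis using N[OF mn(1)] N[OF mn(2)] by (fastforce simp: abs_if split: if_splits)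
      next
        case False
        then show ?thesis using fun_of_outside[of x ?f] d(1) by (auto simp: not_le)
      qed
      have "prod_form ?f ?f \<le> (LINT x|\<nu>. 4 * d\<^sup>2)"
        unfolding prod_form_def
      proof (intro integral_mono integrable_prod)
        fix x
        have "fun_of ?f x * fun_of ?f x = \<bar>fun_of ?f x\<bar>\<^sup>2" by (simp add: power2_eq_square)
        also have "\<dots> \<le> (2 * d)\<^sup>2" by (intro power_mono le) simp
        finally show "fun_of ?f x * fun_of ?f x \<le> 4 * d\<^sup>2" by (simp add: power_mult_distrib)
      qed simp
      also have "\<dots> < 4 * d\<^sup>2 * (mass + 1)" using d(1) by (simp add: mass_def algebra_simps)
      finally show ?thesis using d(2) by simp
    qed
    then show ?thesis by blast
  qed
  with k show ?thesis by blast
qed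

sublocale compact_symmetric_form prod_form
proof (rule compact_symmetric_form.intro)
  show "prod_form f g = prod_form g f" for f g by (simp add: prod_form_def mult.commute)
qed (rule bounded_bilinear_prod_form prod_form_compact, assumption?)+

interpretation Q: bounded_bilinear prod_form by (rule bounded_bilinear_prod_form)

lemma AE_unit_interval: "AE x in \<nu>. x \<in> {0<..<1}"
proof (rule AE_I')
  show "- {0<..<1} \<in> null_sets \<nu>"
    using finite_borel by (simp add: finite_borel_measure_01_def null_sets_def)
qed auto

text \<open>The points split \<open>[0,1]\<close> into pieces of equal mass with respect to \<open>\<Lambda> + \<nu>\<close>, up to atoms.\<close>

lemma equidistributed_points:
  assumes K: "K > 0"
  defines "c \<equiv> (1 + mass) / real K"
  obtains t :: "nat \<Rightarrow> real" where "\<And>i j. i \<le> j \<Longrightarrow> j \<le> K \<Longrightarrow> t i \<le> t j" "t 0 = 0" "t K = 1"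
    "\<And>j. j < K \<Longrightarrow> t (Suc j) - t j \<le> c" "\<And>j. j < K \<Longrightarrow> measure \<nu> {t j<..<t (Suc j)} \<le> c"
proof -
  \<comment> \<open>Distribution function of length plus \<open>\<nu>\<close>-mass, with total
    increase 1 + mass on [0,1]. The points \<open>t j\<close> are its generalized inverse at the
    levels \<open>j * c\<close>.\<close>
  define F where "F x = x + measure \<nu> {..x}" for x
  define A where "A j = {x\<in>{0..1}. real j * c \<le> F x}" for j
  define t where "t j = Inf (A j)" for j
  have c: "c > 0" "real K * c = 1 + mass" using K mass_nonneg by (auto simp: c_def)
  have F_step: "F x + (y - x) \<le> F y" if "x \<le> y" for x y
    using that finite_measure_mono[of "{..x}" "{..y}"] by (simp add: F_def)
  have F_mono: "F x \<le> F y" if "x \<le> y" for x y using F_step[OF that] that by simp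
  have F_le: "F x \<le> x + mass" for x
    using finite_measure_mono[of "{..x}" UNIV] by (simp add: F_def mass_def)
  have "measure \<nu> {..1} = mass"
    unfolding mass_def by (rule finite_measure_eq_AE) (use AE_unit_interval in auto)
  then have F1: "F 1 = 1 + mass" by (simp add: F_def)
  have A1: "1 \<in> A j" if "j \<le> K" for j
  proof -
    have "real j * c \<le> real K * c" using that c by (intro mult_right_mono) auto
    then show ?thesis using c F1 by (simp add: A_def)
  qed
  have bdd: "bdd_below (A j)" for j by (rule bdd_belowI[of _ 0]) (auto simp: A_def)
  have t01: "0 \<le> t j" "t j \<le> 1" if "j \<le> K" for j
    using A1[OF that] bdd[of j] unfolding t_def
    by (auto intro!: cInf_greatest cInf_lower simp: A_def)
  \<comment> \<open>Right-continuity of the distribution function: the level is already reached at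
    the infimum, even if \<open>F\<close> jumps across it there.\<close>
  have t_ge: "real j * c \<le> F (t j)" if j: "j \<le> K" for j
  proof -
    have "(\<lambda>n. measure \<nu> {..t j + 1 / Suc n}) \<longlonglongrightarrow> measure \<nu> (\<Inter>n. {..t j + 1 / Suc n})"
      by (rule finite_Lim_measure_decseq) (auto simp: decseq_def frac_le intro: order_trans)
    also have "(\<Inter>n. {..t j + 1 / Suc n}) = {..t j}"
    proof -
      have "x \<le> t j" if "\<And>n. x \<le> t j + 1 / Suc n" for x
      proof (rule ccontr)
        assume "\<not> x \<le> t j"
        then obtain n where "1 / Suc n < x - t j" by (metis diff_gt_0_iff_gt not_le nat_approx_posE)
        with that[of n] show False by simp
      qed
      moreover have "x \<le> t j + 1 / Suc n" if "x \<le> t j" for x n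
        using that by (smt (verit) divide_nonneg_nonneg of_nat_0_le_iff)
      ultimately show ?thesis by blast
    qed
    finally have "(\<lambda>n. (t j + 1 / Suc n) + measure \<nu> {..t j + 1 / Suc n}) \<longlonglongrightarrow> (t j + 0) + measure \<nu> {..t j}"
      by (intro tendsto_add tendsto_const LIMSEQ_Suc[OF lim_1_over_n])
    moreover have "real j * c \<le> (t j + 1 / Suc n) + measure \<nu> {..t j + 1 / Suc n}" for n
    proof -
      have "Inf (A j) < t j + 1 / Suc n" by (simp add: t_def)
      then obtain a where "a \<in> A j" "a < t j + 1 / Suc n"
        using cInf_less_iff[OF _ bdd] A1[OF j] by blast
      then show ?thesis using F_mono[of a "t j + 1 / Suc n"] by (simp add: A_def F_def)
    qed
    ultimately have "real j * c \<le> (t j + 0) + measure \<nu> {..t j}"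
      by (intro LIMSEQ_le_const) auto
    then show ?thesis by (simp add: F_def)
  qed
  have t_less: "F x < real j * c" if "0 \<le> x" "x < t j" "j \<le> K" for x j
  proof (rule ccontr)
    assume "\<not> F x < real j * c"
    then have "x \<in> A j" using that t01[of j] by (auto simp: A_def)
    then have "t j \<le> x" unfolding t_def by (rule cInf_lower[OF _ bdd])
    with that show False by simp
  qed
  \<comment> \<open>\<open>F\<close> gains less than \<open>c\<close> from \<open>t j\<close> to any
    point strictly before \<open>t (Suc j)\<close>. This bounds both length and mass, and an atom at
    either end is left out.\<close>
  have diff: "F x - F (t j) < c" if "j < K" "t j \<le> x" "x < t (Suc j)" for j x
    using t_ge[of j] t_less[of x "Suc j"] t01[of j] that by (simp add: algebra_simps)
  have mono: "t i \<le> t j" if "i \<le> j" "j \<le> K" for i j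
    unfolding t_def
  proof (rule cInf_superset_mono)
    have "real i * c \<le> real j * c" using that c by (intro mult_right_mono) auto
    then show "A j \<subseteq> A i" by (auto simp: A_def)
  qed (use A1[OF that(2)] bdd in auto)
  have len: "t (Suc j) - t j \<le> c" if "j < K" for j
  proof (rule ccontr)
    assume "\<not> t (Suc j) - t j \<le> c"
    then have "F (t j + c) - F (t j) < c" using c by (intro diff that) auto
    moreover have "F (t j) + c \<le> F (t j + c)" using F_step[of "t j" "t j + c"] c by simp
    ultimately show False by simp
  qed
  have piece: "measure \<nu> {t j<..x} \<le> c" if "j < K" "x < t (Suc j)" for j x
  proof (cases "t j \<le> x")
    case True
    have "measure \<nu> ({..t j} \<union> {t j<..x}) = measure \<nu> {..t j} + measure \<nu> {t j<..x}"
      by (rule finite_measure_Union) auto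
    moreover have "{..t j} \<union> {t j<..x} = {..x}" using True by auto
    ultimately show ?thesis using diff[OF that(1) True that(2)] True by (simp add: F_def)
  qed (use c in auto)
  have "measure \<nu> {t j<..<t (Suc j)} \<le> c" if j: "j < K" for j
  proof -
    have "(\<lambda>n. measure \<nu> {t j<..t (Suc j) - 1 / Suc n}) \<longlonglongrightarrow> measure \<nu> (\<Union>n. {t j<..t (Suc j) - 1 / Suc n})"
    proof (rule finite_Lim_measure_incseq)
      show "incseq (\<lambda>n. {t j<..t (Suc j) - 1 / real (Suc n)})"
      proof (rule incseq_SucI)
        fix n
        have "1 / real (Suc (Suc n)) \<le> 1 / real (Suc n)" by (simp add: frac_le)
        then show "{t j<..t (Suc j) - 1 / real (Suc n)} \<subseteq> {t j<..t (Suc j) - 1 / real (Suc (Suc n))}"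
          by auto
      qed
    qed auto
    also have "(\<Union>n. {t j<..t (Suc j) - 1 / Suc n}) = {t j<..<t (Suc j)}"
    proof -
      have "\<exists>n. x \<le> t (Suc j) - 1 / Suc n" if x: "x < t (Suc j)" for x
      proof -
        obtain n where "1 / Suc n < t (Suc j) - x" using x by (metis diff_gt_0_iff_gt nat_approx_posE)
        then show ?thesis by (intro exI[of _ n]) simp
      qed
      moreover have "x < t (Suc j)" if "x \<le> t (Suc j) - 1 / Suc n" for x n
        using that by (smt (verit) divide_pos_pos of_nat_0_less_iff zero_less_Suc)
      ultimately show ?thesis by (fastforce simp del: of_nat_Suc)
    qed
    finally show ?thesis
      by (rule LIMSEQ_le_const2) (auto intro!: piece j)
  qed
  moreover have "t 0 = 0"
  proof -
    have "0 \<in> A 0" by (simp add: A_def F_def)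
    then have "t 0 \<le> 0" unfolding t_def by (rule cInf_lower[OF _ bdd])
    then show ?thesis using t01[of 0] by simp
  qed
  moreover have "t K = 1"
    using t_ge[of K] F_le[of "t K"] t01(2)[of K] c(2) by simp
  ultimately show ?thesis using that[of t] mono len by blast
qed

text \<open>On each piece \<open>f\<close> starts from the value 0, so \<open>f^2\<close> is at most
  the length bound c times the local energy; integrating over an open piece of mass at most c gives
  the second factor c. Atoms at division points do no harm because \<open>f\<close> vanishes there.
  The points may coincide, hence only \<open>card P \<le> K\<close>.\<close>

lemma prod_form_le_of_zeros:
  assumes K: "K > 0"
  obtains P where "finite P" "card P \<le> K"
    "\<And>f. (\<And>p. p \<in> P \<Longrightarrow> fun_of f p = 0) \<Longrightarrow> prod_form f f \<le> ((1 + mass) / real K)\<^sup>2 * (norm f)\<^sup>2"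
proof -
  define c where "c = (1 + mass) / real K"
  have c: "c > 0" using K mass_nonneg by (simp add: c_def)
  obtain t :: "nat \<Rightarrow> real" where mono: "\<And>i j. i \<le> j \<Longrightarrow> j \<le> K \<Longrightarrow> t i \<le> t j"
    and ends: "t 0 = 0" "t K = 1" and len: "\<And>j. j < K \<Longrightarrow> t (Suc j) - t j \<le> c"
    and piece: "\<And>j. j < K \<Longrightarrow> measure \<nu> {t j<..<t (Suc j)} \<le> c"
    using equidistributed_points[OF K] unfolding c_def by blast
  have "prod_form f f \<le> c\<^sup>2 * (norm f)\<^sup>2" if zero: "\<And>j. j < K \<Longrightarrow> fun_of f (t j) = 0" for f
  proof -
    define E where "E j = (LINT y|lborel. indicator {t j<..t (Suc j)} y * (grad f y)\<^sup>2)" for j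
    have E: "E j \<ge> 0" for j by (simp add: E_def)
    have int_E: "integrable lborel (\<lambda>y. indicator {t j<..t (Suc j)} y * (grad f y)\<^sup>2)" for j
      by (intro integrable_indicator_times integrable_grad_square) simp
    have bound: "fun_of f x * fun_of f x \<le> (\<Sum>j<K. indicator {t j<..<t (Suc j)} x * (c * E j))" for x
    proof (cases "fun_of f x = 0")
      case True
      then show ?thesis using c E by (auto intro!: sum_nonneg)
    next
      case False
      then have x: "0 < x" "x < 1" using fun_of_outside[of x f] by (auto simp: not_le[symmetric])
      define j where "j = Max {j. j \<le> K \<and> t j \<le> x}"
      have J: "finite {j. j \<le> K \<and> t j \<le> x}" "0 \<in> {j. j \<le> K \<and> t j \<le> x}"
        using ends x by auto
      then have "j \<in> {j. j \<le> K \<and> t j \<le> x}" unfolding j_def by (intro Max_in) auto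
      then have j: "j \<le> K" "t j \<le> x" by auto
      have jK: "j < K" using j ends x by (cases "j = K") auto
      have "\<not> t (Suc j) \<le> x"
      proof
        assume "t (Suc j) \<le> x"
        then have "Suc j \<le> j" unfolding j_def using jK J(1) by (intro Max_ge) (auto simp: j_def)
        then show False by simp
      qed
      moreover have "x \<noteq> t j" using zero[OF jK] False by auto
      ultimately have xj: "t j < x" "x < t (Suc j)" using j by auto
      have "(fun_of f x - fun_of f (t j))\<^sup>2
          \<le> (x - t j) * (LINT y|lborel. indicator {t j<..x} y * (grad f y)\<^sup>2)"
        using xj by (intro fun_of_increment_local) simp
      also have "\<dots> \<le> c * E j"
      proof (rule mult_mono)
        show "x - t j \<le> c" using len[OF jK] xj by simp
        show "(LINT y|lborel. indicator {t j<..x} y * (grad f y)\<^sup>2) \<le> E j"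
          unfolding E_def using xj
          by (intro integral_mono int_E integrable_indicator_times integrable_grad_square)
            (auto simp: indicator_def)
      qed (use c in auto)
      also have "c * E j = indicator {t j<..<t (Suc j)} x * (c * E j)" using xj by simp
      also have "\<dots> \<le> (\<Sum>j<K. indicator {t j<..<t (Suc j)} x * (c * E j))"
        using jK c E by (intro member_le_sum) auto
      finally show ?thesis using zero[OF jK] by (simp add: power2_eq_square)
    qed
    have int_ind: "integrable \<nu> (\<lambda>x. indicator {t j<..<t (Suc j)} x * (c * E j))" for j
      by (intro integrable_mult_left integrable_indicator_iff[THEN iffD2] conjI)
        (auto simp: less_top[symmetric])
    have "prod_form f f \<le> (LINT x|\<nu>. (\<Sum>j<K. indicator {t j<..<t (Suc j)} x * (c * E j)))"
      unfolding prod_form_def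
      by (intro integral_mono integrable_prod Bochner_Integration.integrable_sum int_ind bound)
    also have "\<dots> = (\<Sum>j<K. measure \<nu> {t j<..<t (Suc j)} * (c * E j))"
      using int_ind by (subst Bochner_Integration.integral_sum) auto
    also have "\<dots> \<le> (\<Sum>j<K. c * (c * E j))"
      using c E by (intro sum_mono mult_right_mono piece) auto
    also have "\<dots> = c\<^sup>2 * (\<Sum>j<K. E j)" by (simp add: sum_distrib_left power2_eq_square mult.assoc)
    also have "(\<Sum>j<K. E j) \<le> (norm f)\<^sup>2"
    proof -
      have "(\<Sum>j<K. E j) = (LINT y|lborel. (\<Sum>j<K. indicator {t j<..t (Suc j)} y * (grad f y)\<^sup>2))"
        unfolding E_def by (rule Bochner_Integration.integral_sum[symmetric]) (rule int_E)
      also have "\<dots> \<le> (LINT y|lborel. (grad f y)\<^sup>2)"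
      proof (intro integral_mono integrable_grad_square Bochner_Integration.integrable_sum int_E)
        fix y
        have "(\<Sum>j<K. indicator {t j<..t (Suc j)} y :: real)
            = (\<Sum>j<K. indicator {..t (Suc j)} y - indicator {..t j} y)"
        proof (rule sum.cong)
          fix j assume "j \<in> {..<K}"
          then have "t j \<le> t (Suc j)" by (intro mono) auto
          then show "indicator {t j<..t (Suc j)} y = (indicator {..t (Suc j)} y - indicator {..t j} y :: real)"
            by (auto simp: indicator_def)
        qed simp
        also have "\<dots> = indicator {..t K} y - indicator {..t 0} y"
          by (rule sum_lessThan_telescope)
        also have "\<dots> \<le> 1" by (auto simp: indicator_def)
        finally have "(\<Sum>j<K. indicator {t j<..t (Suc j)} y) * (grad f y)\<^sup>2 \<le> 1 * (grad f y)\<^sup>2"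
          by (rule mult_right_mono) simp
        then show "(\<Sum>j<K. indicator {t j<..t (Suc j)} y * (grad f y)\<^sup>2) \<le> (grad f y)\<^sup>2"
          by (simp add: sum_distrib_right)
      qed
      finally show ?thesis by (simp add: norm_h10_square)
    qed
    finally show ?thesis by (simp add: mult_left_mono)
  qed
  then show ?thesis
    using card_image_le[of "{..<K}" t] by (intro that[of "t ` {..<K}"]) (auto simp: c_def)
qed

section \<open>Eigenspaces inside the Hilbert space\<close>

definition form_space :: "h10 set" where
  "form_space = {f. fun_of f \<in> C_space \<nu>}"

definition eig :: "real \<Rightarrow> h10 set" where
  "eig \<mu> = {f \<in> form_space. \<forall>g\<in>form_space. inner f g = \<mu> * prod_form f g}"

lemma form_dom_eq: "form_dom \<nu> = fun_of ` form_space"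
proof -
  have "H10 = range fun_of" using fun_of fun_of_cases by blast
  then show ?thesis unfolding form_dom_def form_space_def by (simp add: image_def set_eq_iff) metis
qed

lemma eigenspace_eq: "eigenspace \<nu> \<mu> = fun_of ` eig \<mu>"
proof -
  have "{y \<in> h ` A. \<forall>z\<in>h ` A. R y z} = h ` {x\<in>A. \<forall>z\<in>A. R (h x) (h z)}"
    for h :: "h10 \<Rightarrow> real \<Rightarrow> real" and A R
    by blast
  then show ?thesis
    unfolding eigenspace_def eig_def form_dom_eq prod_form_def inner_h10_def .
qed

lemma fun_of_eq_zero_iff: "fun_of f = (\<lambda>x. 0) \<longleftrightarrow> f = 0"
  using fun_of_inject[of f 0] unfolding zero_h10.rep_eq .

lemma is_eigenvalue_iff: "is_eigenvalue \<nu> \<mu> \<longleftrightarrow> (\<exists>f\<in>eig \<mu>. f \<noteq> 0)"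
  by (simp add: is_eigenvalue_def eigenspace_eq fun_of_eq_zero_iff)

lemma multiplicity_ev_eq: "multiplicity_ev \<nu> \<mu> = dim (eig \<mu>)"
  by (simp add: multiplicity_ev_def eigenspace_eq dim_fun_of_image)

lemma subspace_form_space: "subspace form_space"
proof (rule subspaceI)
  show "0 \<in> form_space" by (auto simp: form_space_def C_space_def zero_h10.rep_eq intro!: exI[of _ 0])
next
  fix f g assume fg: "f \<in> form_space" "g \<in> form_space"
  show "f + g \<in> form_space"
    unfolding form_space_def C_space_def
  proof (intro CollectI conjI ballI continuous_fun_of)
    fix I assume "I \<in> components ({0..1} - supp_measure \<nu>)"
    then obtain a b a' b' where "\<forall>x\<in>I. fun_of f x = a * x + b" "\<forall>x\<in>I. fun_of g x = a' * x + b'"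
      using fg unfolding form_space_def C_space_def by blast
    then show "\<exists>a b. \<forall>x\<in>I. fun_of (f + g) x = a * x + b"
      by (intro exI[of _ "a + a'"] exI[of _ "b + b'"]) (auto simp: algebra_simps)
  qed
next
  fix r f assume f: "f \<in> form_space"
  show "r *\<^sub>R f \<in> form_space"
    unfolding form_space_def C_space_def
  proof (intro CollectI conjI ballI continuous_fun_of)
    fix I assume "I \<in> components ({0..1} - supp_measure \<nu>)"
    then obtain a b where "\<forall>x\<in>I. fun_of f x = a * x + b"
      using f unfolding form_space_def C_space_def by blast
    then show "\<exists>a b. \<forall>x\<in>I. fun_of (r *\<^sub>R f) x = a * x + b"
      by (intro exI[of _ "r * a"] exI[of _ "r * b"]) (auto simp: algebra_simps)
  qed
qed

lemma subspace_eig: "subspace (eig \<mu>)"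
proof (rule subspaceI)
  show "0 \<in> eig \<mu>"
    using subspace_0[OF subspace_form_space] by (simp add: eig_def Q.zero_left)
  show "f + g \<in> eig \<mu>" if "f \<in> eig \<mu>" "g \<in> eig \<mu>" for f g
    using that subspace_add[OF subspace_form_space]
    by (simp add: eig_def inner_add_left Q.add_left distrib_left)
  show "r *\<^sub>R f \<in> eig \<mu>" if "f \<in> eig \<mu>" for r f
    using that subspace_scale[OF subspace_form_space]
    by (simp add: eig_def Q.scaleR_left mult.left_commute)
qed

lemma eig_orthogonal:
  assumes "f \<in> eig \<mu>" "g \<in> eig \<mu>'" "\<mu> \<noteq> \<mu>'"
  shows "inner f g = 0" "prod_form f g = 0"
proof -
  have "inner f g = \<mu> * prod_form f g" using assms by (auto simp: eig_def)
  moreover have "inner g f = \<mu>' * prod_form g f" using assms by (auto simp: eig_def)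
  ultimately have "\<mu> * prod_form f g = \<mu>' * prod_form f g"
    using symmetric[of f g] by (simp add: inner_commute)
  then show "prod_form f g = 0" using assms(3) by simp
  with \<open>inner f g = \<mu> * prod_form f g\<close> show "inner f g = 0" by simp
qed

text \<open>With more than \<open>K\<close> basis vectors, some nontrivial combination
  \<open>f\<close> vanishes at the \<open>K\<close> points. Eigenvectors for different eigenvalues
  are orthogonal for both forms, so the energy of \<open>f\<close> is at most x times its
  \<open>\<nu>\<close>-form, hence at most \<open>x * C < 1\<close> times itself, and
  \<open>f\<close> is zero.\<close>

lemma eig_family_card_le:
  assumes K: "K > 0" "x * ((1 + mass) / real K)\<^sup>2 < 1" and x: "0 \<le> x"
    and M: "finite M" "\<And>\<mu>. \<mu> \<in> M \<Longrightarrow> \<mu> \<le> x"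
    and B: "\<And>\<mu>. \<mu> \<in> M \<Longrightarrow> finite (B \<mu>)" "\<And>\<mu>. \<mu> \<in> M \<Longrightarrow> independent (B \<mu>)"
      "\<And>\<mu>. \<mu> \<in> M \<Longrightarrow> B \<mu> \<subseteq> eig \<mu>"
  shows "(\<Sum>\<mu>\<in>M. card (B \<mu>)) \<le> K"
proof (rule ccontr)
  assume "\<not> ?thesis"
  then have big: "K < card (Sigma M B)" using M(1) B(1) by (simp add: card_SigmaI)
  define C where "C = ((1 + mass) / real K)\<^sup>2"
  obtain P where P: "finite P" "card P \<le> K"
    and le: "\<And>f. (\<And>p. p \<in> P \<Longrightarrow> fun_of f p = 0) \<Longrightarrow> prod_form f f \<le> C * (norm f)\<^sup>2"
    using prod_form_le_of_zeros[OF K(1)] unfolding C_def by blast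
  have fin: "finite (Sigma M B)" using M(1) B(1) by auto
  have "card P < card (Sigma M B)" using P(2) big by simp
  \<comment> \<open>Coefficients are indexed by pairs, since the sets \<open>B \<mu>\<close> for
    different eigenvalues are not assumed disjoint.\<close>
  then obtain c where c: "\<exists>i\<in>Sigma M B. c i \<noteq> 0"
    "\<And>p. p \<in> P \<Longrightarrow> (\<Sum>i\<in>Sigma M B. c i * fun_of (snd i) p) = 0"
    using underdetermined_system_nontrivial[OF P(1) fin, of "\<lambda>p i. fun_of (snd i) p"] by blast
  define F where "F \<mu> = (\<Sum>b\<in>B \<mu>. c (\<mu>, b) *\<^sub>R b)" for \<mu>
  define f where "f = (\<Sum>\<mu>\<in>M. F \<mu>)"
  have F: "F \<mu> \<in> eig \<mu>" if "\<mu> \<in> M" for \<mu>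
    unfolding F_def using subspace_eig B(3)[OF that]
    by (intro subspace_sum subspace_scale) auto
  have "fun_of f p = 0" if "p \<in> P" for p
    using c(2)[OF that] M(1) B(1) by (simp add: f_def F_def sum.Sigma split_def)
  then have fC: "prod_form f f \<le> C * (norm f)\<^sup>2" by (rule le)
  have diag: "inner f f = (\<Sum>\<mu>\<in>M. inner (F \<mu>) (F \<mu>))" "prod_form f f = (\<Sum>\<mu>\<in>M. prod_form (F \<mu>) (F \<mu>))"
  proof -
    have "inner (F \<mu>) f = inner (F \<mu>) (F \<mu>)" "prod_form (F \<mu>) f = prod_form (F \<mu>) (F \<mu>)" if \<mu>: "\<mu> \<in> M" for \<mu>
    proof -
      have "inner (F \<mu>) f = (\<Sum>\<mu>'\<in>M. if \<mu>' = \<mu> then inner (F \<mu>) (F \<mu>) else 0)"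
        unfolding f_def inner_sum_right using eig_orthogonal(1)[OF F[OF \<mu>] F]
        by (intro sum.cong) auto
      then show "inner (F \<mu>) f = inner (F \<mu>) (F \<mu>)" using M(1) \<mu> by simp
      have "prod_form (F \<mu>) f = (\<Sum>\<mu>'\<in>M. if \<mu>' = \<mu> then prod_form (F \<mu>) (F \<mu>) else 0)"
        unfolding f_def Q.sum_right using eig_orthogonal(2)[OF F[OF \<mu>] F]
        by (intro sum.cong) auto
      then show "prod_form (F \<mu>) f = prod_form (F \<mu>) (F \<mu>)" using M(1) \<mu> by simp
    qed
    moreover have "inner f f = (\<Sum>\<mu>\<in>M. inner (F \<mu>) f)" "prod_form f f = (\<Sum>\<mu>\<in>M. prod_form (F \<mu>) f)"
      by (subst (1) f_def, simp add: inner_sum_left Q.sum_left)+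
    ultimately show "inner f f = (\<Sum>\<mu>\<in>M. inner (F \<mu>) (F \<mu>))"
      "prod_form f f = (\<Sum>\<mu>\<in>M. prod_form (F \<mu>) (F \<mu>))" by simp_all
  qed
  have "inner f f \<le> (\<Sum>\<mu>\<in>M. x * prod_form (F \<mu>) (F \<mu>))"
    unfolding diag
  proof (rule sum_mono)
    fix \<mu> assume \<mu>: "\<mu> \<in> M"
    have "inner (F \<mu>) (F \<mu>) = \<mu> * prod_form (F \<mu>) (F \<mu>)" using F[OF \<mu>] by (auto simp: eig_def)
    also have "\<dots> \<le> x * prod_form (F \<mu>) (F \<mu>)"
      by (intro mult_right_mono M(2)[OF \<mu>] prod_form_nonneg)
    finally show "inner (F \<mu>) (F \<mu>) \<le> x * prod_form (F \<mu>) (F \<mu>)" .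
  qed
  also have "\<dots> = x * prod_form f f" by (simp add: diag sum_distrib_left)
  also have "\<dots> \<le> x * (C * (norm f)\<^sup>2)" by (intro mult_left_mono fC x)
  finally have "(1 - x * C) * (norm f)\<^sup>2 \<le> 0"
    by (simp add: power2_norm_eq_inner algebra_simps)
  then have "norm f = 0" using K(2) unfolding C_def[symmetric] by (simp add: mult_le_0_iff)
  then have "(\<Sum>\<mu>\<in>M. inner (F \<mu>) (F \<mu>)) = 0" by (simp flip: diag)
  then have F0: "F \<mu> = 0" if "\<mu> \<in> M" for \<mu>
    using that M(1) by (subst (asm) sum_nonneg_eq_0_iff) auto
  obtain \<mu> b where \<mu>: "\<mu> \<in> M" "b \<in> B \<mu>" "c (\<mu>, b) \<noteq> 0" using c(1) by auto
  then show False
    using F0[OF \<mu>(1)] B(1,2)[OF \<mu>(1)] unfolding F_def by (auto simp: dependent_finite)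
qed

context
  fixes K :: nat and x :: real
  assumes K: "K > 0" "x * ((1 + mass) / real K)\<^sup>2 < 1" and x: "0 \<le> x"
begin

text \<open>The bound for finite families passes to all independent sets: an infinite one would
  contain \<open>Suc K\<close> elements.\<close>

lemma independent_eig_card_le:
  assumes "\<mu> \<le> x" "B \<subseteq> eig \<mu>" "independent B"
  shows "finite B \<and> card B \<le> K"
proof -
  have le: "card A \<le> K" if "finite A" "A \<subseteq> B" for A
    using eig_family_card_le[OF K x, of "{\<mu>}" "\<lambda>_. A"] that assms independent_mono by auto
  have "finite B"
  proof (rule ccontr)
    assume "infinite B"
    then obtain A where "finite A" "card A = Suc K" "A \<subseteq> B" using infinite_arbitrarily_large by metis
    with le[of A] show False by simp
  qed
  with le[of B] show ?thesis by simp
qed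

lemma finite_eigenvalues: "finite {\<mu>. is_eigenvalue \<nu> \<mu> \<and> \<mu> \<le> x}"
proof (rule ccontr)
  assume "infinite {\<mu>. is_eigenvalue \<nu> \<mu> \<and> \<mu> \<le> x}"
  then obtain M where M: "finite M" "card M = Suc K" "M \<subseteq> {\<mu>. is_eigenvalue \<nu> \<mu> \<and> \<mu> \<le> x}"
    using infinite_arbitrarily_large by metis
  then have "\<forall>\<mu>\<in>M. \<exists>f. f \<in> eig \<mu> \<and> f \<noteq> 0" using is_eigenvalue_iff by auto
  then obtain h where h: "\<And>\<mu>. \<mu> \<in> M \<Longrightarrow> h \<mu> \<in> eig \<mu>" "\<And>\<mu>. \<mu> \<in> M \<Longrightarrow> h \<mu> \<noteq> 0" by metis
  have "(\<Sum>\<mu>\<in>M. card {h \<mu>}) \<le> K"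
    using M h by (intro eig_family_card_le[OF K x]) auto
  with M show False by simp
qed

lemma eigenvalue_count_le: "eigenvalue_count \<nu> x \<le> K"
proof -
  have "\<exists>B. B \<subseteq> eig \<mu> \<and> independent B \<and> card B = dim (eig \<mu>)" for \<mu>
    using basis_exists[of "eig \<mu>"] by metis
  then obtain B where B: "\<And>\<mu>. B \<mu> \<subseteq> eig \<mu>" "\<And>\<mu>. independent (B \<mu>)" "\<And>\<mu>. card (B \<mu>) = dim (eig \<mu>)"
    by metis
  have "eigenvalue_count \<nu> x = (\<Sum>\<mu> | is_eigenvalue \<nu> \<mu> \<and> \<mu> \<le> x. card (B \<mu>))"
    by (simp add: eigenvalue_count_def multiplicity_ev_eq B(3))
  also have "\<dots> \<le> K"
    using finite_eigenvalues B independent_eig_card_le by (intro eig_family_card_le[OF K x]) auto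
  finally show ?thesis .
qed

text \<open>The eigenspaces up to \<open>x\<close> cover \<open>F\<close>, and each contains at most
  as many members of \<open>F\<close> as its dimension. Finite bases are essential here, because
  otherwise \<open>dim\<close> would be the default 0.\<close>

lemma card_le_eigenvalue_count:
  assumes F: "finite F" "independent F" "\<And>f. f \<in> F \<Longrightarrow> \<exists>\<mu>\<le>x. f \<in> eig \<mu>"
  shows "card F \<le> eigenvalue_count \<nu> x"
proof -
  let ?S = "{\<mu>. is_eigenvalue \<nu> \<mu> \<and> \<mu> \<le> x}"
  have nz: "0 \<notin> F" using F(2) dependent_zero by blast
  have "F \<subseteq> (\<Union>\<mu>\<in>?S. F \<inter> eig \<mu>)"
  proof
    fix f assume f: "f \<in> F"
    then obtain \<mu> where "\<mu> \<le> x" "f \<in> eig \<mu>" using F(3) by blast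
    moreover have "f \<noteq> 0" using f nz by auto
    ultimately show "f \<in> (\<Union>\<mu>\<in>?S. F \<inter> eig \<mu>)" using f is_eigenvalue_iff by blast
  qed
  then have "card F \<le> card (\<Union>\<mu>\<in>?S. F \<inter> eig \<mu>)"
    using F(1) finite_eigenvalues by (intro card_mono) auto
  also have "\<dots> \<le> (\<Sum>\<mu>\<in>?S. card (F \<inter> eig \<mu>))"
    by (rule card_UN_le[OF finite_eigenvalues])
  also have "\<dots> \<le> (\<Sum>\<mu>\<in>?S. dim (eig \<mu>))"
  proof (rule sum_mono)
    fix \<mu> assume "\<mu> \<in> ?S"
    obtain B where B: "B \<subseteq> eig \<mu>" "independent B" "eig \<mu> \<subseteq> span B" "card B = dim (eig \<mu>)"
      using basis_exists[of "eig \<mu>"] by metis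
    have "finite B" using independent_eig_card_le[OF _ B(1,2)] \<open>\<mu> \<in> ?S\<close> by simp
    moreover have "independent (F \<inter> eig \<mu>)" using F(2) independent_mono by blast
    ultimately show "card (F \<inter> eig \<mu>) \<le> dim (eig \<mu>)"
      using independent_span_bound[of B "F \<inter> eig \<mu>"] B(3,4) by auto
  qed
  finally show ?thesis by (simp add: eigenvalue_count_def multiplicity_ev_eq)
qed

end

end

section \<open>Lower bound for the eigenvalue count\<close>

lemma zero_primitive_fun_of:
  assumes "zero_primitive h u"
  obtains f where "fun_of f = h" "AE x in lborel. grad f x = u x"
proof -
  obtain f where f: "fun_of f = h" using zero_primitive_H10[OF assms] fun_of_cases by metis
  then show ?thesis using that[of f] zero_primitive_unique[OF grad[of f], of u] assms by simp
qed

lemma inner_h10_AE: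
  assumes "AE x in lborel. grad f x = u x" "AE x in lborel. grad g x = v x"
    and [measurable]: "u \<in> borel_measurable borel" "v \<in> borel_measurable borel"
  shows "inner f g = (LINT x|lborel. u x * v x)"
  unfolding inner_h10_eq by (rule integral_cong_AE) (use assms(1,2) in auto)

context measure_01
begin

text \<open>Each point of \<open>S\<close> has a null neighbourhood, and finitely many of them cover
  \<open>S\<close>.\<close>

lemma compact_null:
  assumes "compact S" "S \<inter> supp_measure \<nu> = {}"
  shows "measure \<nu> S = 0"
proof -
  have "\<exists>U. open U \<and> x \<in> U \<and> emeasure \<nu> U = 0" if "x \<in> S" for x
  proof -
    have "x \<notin> supp_measure \<nu>" using that assms(2) by auto
    then show ?thesis by (auto simp: supp_measure_def zero_less_iff_neq_zero)
  qed
  then obtain U where U: "\<And>x. x \<in> S \<Longrightarrow> open (U x)" "\<And>x. x \<in> S \<Longrightarrow> x \<in> U x"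
    "\<And>x. x \<in> S \<Longrightarrow> emeasure \<nu> (U x) = 0" by metis
  obtain D where D: "D \<subseteq> S" "finite D" "S \<subseteq> (\<Union>x\<in>D. U x)"
    using compactE_image[OF assms(1), of S U] U by blast
  have "(\<Union>x\<in>D. U x) \<in> null_sets \<nu>"
    using D U by (intro null_sets_UN' countable_finite) (auto simp: null_sets_def)
  moreover have "S \<in> sets \<nu>" using assms(1) by (simp add: borel_compact)
  ultimately have "S \<in> null_sets \<nu>" using D(3) null_sets_subset by blast
  then show ?thesis by (simp add: measure_eq_0_null_sets)
qed

text \<open>Testing the weak equation with \<open>f\<close> minus its affine interpolation on \<open>[a,b]\<close>.\<close>

lemma eigenfunction_affine_on_null_interval:
  assumes eq: "\<And>h. inner f h = \<mu> * prod_form f h"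
    and ab: "0 \<le> a" "a < b" "b \<le> 1" and null: "measure \<nu> {a..b} = 0"
    and x: "x \<in> {a..b}"
  shows "fun_of f x = fun_of f a + (fun_of f b - fun_of f a) / (b - a) * (x - a)"
proof -
  define s where "s = (fun_of f b - fun_of f a) / (b - a)"
  \<comment> \<open>Gradient of the interpolation error: the deviation of \<open>grad f\<close> from
    its mean slope on \<open>(a,b]\<close>. Its mean is zero, so the primitive \<open>h\<close>
    vanishes outside \<open>[a,b]\<close>.\<close>
  define u where "u t = indicator {a<..b} t * (grad f t - s)" for t
  define h where "h y = (LINT t|lborel. indicator {..y} t * u t)" for y
  have [measurable]: "u \<in> borel_measurable borel" unfolding u_def by measurable
  have ind: "integrable lborel (\<lambda>t. indicator {c<..d} t * grad f t)" for c d
    by (intro integrable_indicator_times integrable_grad) simp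
  have int_ind: "(LINT t|lborel. indicator {c<..d} t * grad f t) = fun_of f d - fun_of f c" if "c \<le> d" for c d
  proof -
    have "fun_of f d - fun_of f c
        = (LINT t|lborel. indicator {..d} t * grad f t - indicator {..c} t * grad f t)"
      unfolding fun_of_eq_integral
      by (intro Bochner_Integration.integral_diff[symmetric] integrable_indicator_times integrable_grad) auto
    also have "\<dots> = (LINT t|lborel. indicator {c<..d} t * grad f t)"
      by (intro Bochner_Integration.integral_cong) (use that in \<open>auto simp: indicator_def\<close>)
    finally show ?thesis by simp
  qed
  have int_u: "(LINT t|lborel. indicator {a<..y} t * (grad f t - s)) = fun_of f y - fun_of f a - s * (y - a)"
    if "a \<le> y" for y
  proof -
    have "(LINT t|lborel. indicator {a<..y} t * (grad f t - s))
        = (LINT t|lborel. indicator {a<..y} t * grad f t - s * indicator {a<..y} t)"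
      by (intro Bochner_Integration.integral_cong) (auto simp: algebra_simps)
    also have "\<dots> = (LINT t|lborel. indicator {a<..y} t * grad f t) - (LINT t|lborel. s * indicator {a<..y} t)"
      using that by (intro Bochner_Integration.integral_diff ind) auto
    also have "\<dots> = fun_of f y - fun_of f a - s * (y - a)"
      using that by (simp add: int_ind)
    finally show ?thesis .
  qed
  have total: "(LINT t|lborel. u t) = 0"
    using int_u[of b] ab unfolding u_def by (simp add: s_def)
  have u0: "u t = 0" if "t \<notin> {0..1}" for t using that ab by (auto simp: u_def)
  have u2: "integrable lborel (\<lambda>t. (u t)\<^sup>2)"
  proof (rule Bochner_Integration.integrable_bound)
    show "integrable lborel (\<lambda>t. 2 * (grad f t)\<^sup>2 + 2 * s\<^sup>2 * indicator {a<..b} t)"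
      using ab
      by (intro Bochner_Integration.integrable_add integrable_mult_right integrable_grad_square) auto
    have "(p - s)\<^sup>2 \<le> 2 * p\<^sup>2 + 2 * s\<^sup>2" for p :: real
      using zero_le_power2[of "p + s"] by (simp add: power2_eq_square algebra_simps)
    then have "(u t)\<^sup>2 \<le> 2 * (grad f t)\<^sup>2 + 2 * s\<^sup>2 * indicator {a<..b} t" for t
      by (auto simp: u_def indicator_def)
    then show "AE t in lborel. norm ((u t)\<^sup>2) \<le> norm (2 * (grad f t)\<^sup>2 + 2 * s\<^sup>2 * indicator {a<..b} t)"
      by (intro AE_I2) simp
  qed simp
  have "zero_primitive h u"
    using u0 u2 total by (auto simp: zero_primitive_def h_def)
  then obtain g where g: "fun_of g = h" "AE t in lborel. grad g t = u t"
    by (rule zero_primitive_fun_of)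
  have h_in: "h y = fun_of f y - fun_of f a - s * (y - a)" if "y \<in> {a..b}" for y
  proof -
    have "h y = (LINT t|lborel. indicator {a<..y} t * (grad f t - s))"
      unfolding h_def u_def
      by (intro Bochner_Integration.integral_cong) (use that in \<open>auto simp: indicator_def\<close>)
    then show ?thesis using int_u that by simp
  qed
  have h_out: "h y = 0" if "y \<notin> {a..b}" for y
  proof (cases "y < a")
    case True
    then have "(\<lambda>t. indicator {..y} t * u t) = (\<lambda>_. 0)"
      by (auto simp: u_def indicator_def fun_eq_iff)
    then show ?thesis by (simp add: h_def)
  next
    case False
    then have "(\<lambda>t. indicator {..y} t * u t) = u"
      using that by (auto simp: u_def indicator_def fun_eq_iff)
    then show ?thesis using total by (simp add: h_def)
  qed
  \<comment> \<open>On \<open>(a,b]\<close> the gradient of \<open>f\<close> is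
    \<open>u + s\<close>, and the constant part is orthogonal to the mean-zero function
    \<open>u\<close>.\<close>
  have "inner f g = (LINT t|lborel. grad f t * u t)"
    by (rule inner_h10_AE) (use g in auto)
  also have "\<dots> = (LINT t|lborel. (u t)\<^sup>2 + s * u t)"
    by (intro Bochner_Integration.integral_cong) (auto simp: u_def indicator_def power2_eq_square algebra_simps)
  also have "\<dots> = (LINT t|lborel. (u t)\<^sup>2)"
    using u2 integrable_unit_interval_square[OF _ u0 u2] total by simp
  also have "\<dots> = inner g g"
    using inner_h10_AE[OF g(2) g(2)] by (simp add: power2_eq_square)
  finally have "inner f g = inner g g" .
  moreover have "prod_form f g = 0"
    unfolding prod_form_def
  proof (rule integral_eq_zero_AE)
    have "{a..b} \<in> null_sets \<nu>" using null by (simp add: null_sets_def emeasure_eq_measure)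
    then have "AE y in \<nu>. y \<notin> {a..b}" by (rule AE_not_in)
    then show "AE y in \<nu>. fun_of f y * fun_of g y = 0"
      by eventually_elim (simp add: g(1) h_out)
  qed
  ultimately have "g = 0" using eq[of g] by simp
  then have "h x = 0" using g(1) by (metis fun_of_simps(1))
  then show ?thesis using h_in[OF x] by (simp add: s_def)
qed

text \<open>Here the weak equation is tested against all of H^1_0. Compact subintervals of a
  component of the complement of the support are null, so \<open>f\<close> is affine on each of them
  and belongs to the form domain.\<close>

lemma eigenfunction_in_eig:
  assumes eq: "\<And>h. inner f h = \<mu> * prod_form f h"
  shows "f \<in> eig \<mu>"
proof -
  have "\<exists>a b. \<forall>x\<in>I. fun_of f x = a * x + b" if I: "I \<in> components ({0..1} - supp_measure \<nu>)" for I
  proof (cases "\<exists>p\<in>I. \<exists>q\<in>I. p < q")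
    case False
    obtain p where p: "p \<in> I" using in_components_nonempty[OF I] by auto
    have "x = p" if "x \<in> I" for x
      using False p that by (cases x p rule: linorder_cases) auto
    then show ?thesis by (intro exI[of _ 0] exI[of _ "fun_of f p"]) auto
  next
    case True
    then obtain p q where pq: "p \<in> I" "q \<in> I" "p < q" by blast
    have sub: "I \<subseteq> {0..1} - supp_measure \<nu>" using I by (rule in_components_subset)
    have "is_interval I" using I in_components_connected is_interval_connected_1 by blast
    then have seg: "{y..z} \<subseteq> I" if "y \<in> I" "z \<in> I" for y z
      using that by (meson atLeastAtMost_iff mem_is_interval_1_I subsetI)
    define s where "s = (fun_of f q - fun_of f p) / (q - p)"
    have "fun_of f x = fun_of f p + s * (x - p)" if x: "x \<in> I" for x
    proof -
      \<comment> \<open>An interval containing \<open>x\<close> together with the fixed points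
        \<open>p < q\<close>: the latter force its slope to be \<open>s\<close>, so one affine
        function serves the whole component.\<close>
      define y where "y = min x p"
      define z where "z = max x q"
      have yz: "y \<in> I" "z \<in> I" "y < z" "p \<in> {y..z}" "q \<in> {y..z}" "x \<in> {y..z}"
        using x pq by (auto simp: y_def z_def min_def max_def)
      have "measure \<nu> {y..z} = 0"
        using seg[OF yz(1,2)] sub by (intro compact_null) auto
      moreover have "0 \<le> y" "z \<le> 1" using yz sub by auto
      ultimately obtain s' where aff: "\<And>w. w \<in> {y..z} \<Longrightarrow> fun_of f w = fun_of f y + s' * (w - y)"
        using eigenfunction_affine_on_null_interval[OF eq, of y z] yz(3) by blast
      have "fun_of f q - fun_of f p = s' * (q - p)"
        using aff[OF yz(4)] aff[OF yz(5)] by (simp add: algebra_simps)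
      then have "s = s'" using pq(3) by (simp add: s_def)
      then show ?thesis using aff[OF yz(4)] aff[OF yz(6)] by (simp add: algebra_simps)
    qed
    then show ?thesis
      by (intro exI[of _ s] exI[of _ "fun_of f p - s * p"]) (auto simp: algebra_simps)
  qed
  then show ?thesis
    using eq by (auto simp: eig_def form_space_def C_space_def continuous_fun_of)
qed

lemma eigenvalue_count_upper:
  assumes "x \<ge> 0"
  shows "eigenvalue_count \<nu> x \<le> (1 + mass) * sqrt x + 1"
    and "\<exists>K>0. x * ((1 + mass) / real K)\<^sup>2 < 1"
proof -
  \<comment> \<open>The least positive integer exceeding \<open>(1 + mass) * sqrt x\<close>, so that
    the smallness condition holds strictly.\<close>
  define K where "K = nat \<lfloor>(1 + mass) * sqrt x\<rfloor> + 1"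
  have nn: "(1 + mass) * sqrt x \<ge> 0" using mass_nonneg assms by simp
  have K: "(1 + mass) * sqrt x < real K" "real K \<le> (1 + mass) * sqrt x + 1" "K > 0"
    using nn unfolding K_def by linarith+
  have "((1 + mass) * sqrt x)\<^sup>2 < (real K)\<^sup>2" using nn K by (intro power_strict_mono) auto
  then have small: "x * ((1 + mass) / real K)\<^sup>2 < 1"
    using K(3) assms unfolding power_mult_distrib power_divide by (simp add: divide_less_eq mult.commute)
  then show "\<exists>K>0. x * ((1 + mass) / real K)\<^sup>2 < 1" using K by blast
  show "eigenvalue_count \<nu> x \<le> (1 + mass) * sqrt x + 1"
    using eigenvalue_count_le[OF K(3) small assms] K(2) by linarith
qed

text \<open>Eigenvectors of the \<open>\<nu>\<close>-form with eigenvalue \<open>S \<ge> c\<close>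
  solve the weak equation with \<open>1 / S \<le> 1 / c \<le> x\<close>; orthonormality gives their
  independence.\<close>

lemma eigenvalue_count_lower:
  assumes B: "finite B" "independent B" and c: "c > 0" "1 / c \<le> x"
    and le: "\<And>v. v \<in> span B \<Longrightarrow> c * (norm v)\<^sup>2 \<le> prod_form v v"
  shows "card B \<le> eigenvalue_count \<nu> x"
proof -
  have x: "x \<ge> 0" using c by (meson divide_nonneg_pos order_trans zero_le_one)
  obtain F where F: "finite F" "card F = card B" "pairwise orthogonal F"
    "\<And>e. e \<in> F \<Longrightarrow> norm e = 1"
    "\<And>e. e \<in> F \<Longrightarrow> \<exists>S\<ge>c. \<forall>h. prod_form e h = S * inner e h"
    using orthonormal_eigenvectors[OF B c(1) le] by blast
  have "\<exists>\<mu>\<le>x. e \<in> eig \<mu>" if "e \<in> F" for e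
  proof -
    obtain S where S: "S \<ge> c" "\<And>h. prod_form e h = S * inner e h" using F(5) \<open>e \<in> F\<close> by blast
    have "1 / S \<le> 1 / c" using S c by (intro divide_left_mono) auto
    then have "1 / S \<le> x" using c by simp
    moreover have "e \<in> eig (1 / S)" using S c by (intro eigenfunction_in_eig) auto
    ultimately show ?thesis by blast
  qed
  moreover have "independent F"
    using F(3,4) by (intro pairwise_orthogonal_independent) (auto dest: F(4))
  moreover obtain K where "K > 0" "x * ((1 + mass) / real K)\<^sup>2 < 1"
    using eigenvalue_count_upper(2)[OF x] by blast
  ultimately show ?thesis
    using card_le_eigenvalue_count[of K x F] F(1,2) x by simp
qed

end

section \<open>Trapezoidal test functions\<close>

definition cell :: "nat \<Rightarrow> nat \<Rightarrow> real set" where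
  "cell K k = {real k / real K <.. (real k + 1) / real K}"

lemma cell_borel [simp, measurable]: "cell K k \<in> sets borel"
  by (simp add: cell_def)

lemma cell_unique:
  assumes "K > 0" "y \<in> cell K k" "y \<in> cell K l"
  shows "k = l"
proof -
  have "real k < real K * y" "real K * y \<le> real k + 1" "real l < real K * y" "real K * y \<le> real l + 1"
    using assms by (auto simp: cell_def field_simps)
  then show ?thesis by linarith
qed

lemma emeasure_cell: "emeasure lborel (cell K k) = ennreal (1 / real K)"
proof -
  have "real k / real K \<le> (real k + 1) / real K" by (simp add: divide_right_mono)
  then show ?thesis by (simp add: cell_def diff_divide_distrib[symmetric])
qed

lemma measure_cell [simp]: "measure lborel (cell K k) = 1 / real K"
  by (simp add: measure_def emeasure_cell)

lemma integrable_indicator_cell: "integrable lborel (indicator (cell K k) :: real \<Rightarrow> real)"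
  by (intro integrable_real_indicator) (auto simp: emeasure_cell)

text \<open>Derivative of a trapezoid of height 1 that rises on cell \<open>j\<close>, is constant
  on cell \<open>j + 1\<close> and falls on cell \<open>j + 2\<close>. The factor \<open>K\<close>
  is the slope needed on a cell of length 1/K.\<close>

definition bump_slope :: "nat \<Rightarrow> nat \<Rightarrow> real \<Rightarrow> real" where
  "bump_slope K j t = real K * (indicator (cell K j) t - indicator (cell K (j + 2)) t)"

lemma bump_slope_measurable [measurable]: "bump_slope K j \<in> borel_measurable borel"
  unfolding bump_slope_def by measurable

lemma bump_exists:
  assumes j: "j + 3 \<le> K"
  shows "\<exists>f. (AE t in lborel. grad f t = bump_slope K j t) \<and>
    (\<forall>x\<in>cell K (j + 1). fun_of f x = 1) \<and>
    (\<forall>k. k < j \<or> j + 2 < k \<longrightarrow> (\<forall>x\<in>cell K k. fun_of f x = 0))"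
proof -
  have K: "K > 0" using j by simp
  define h where "h x = (LINT t|lborel. indicator {..x} t * bump_slope K j t)" for x
  have int: "integrable lborel (bump_slope K j)"
    unfolding bump_slope_def by (intro integrable_mult_right Bochner_Integration.integrable_diff integrable_indicator_cell)
  have total: "(LINT t|lborel. bump_slope K j t) = 0"
    unfolding bump_slope_def
    by (simp add: Bochner_Integration.integral_diff[OF integrable_indicator_cell integrable_indicator_cell])
  have sq: "(bump_slope K j t)\<^sup>2 = (real K)\<^sup>2 * (indicator (cell K j) t + indicator (cell K (j + 2)) t)" for t
    using cell_unique[OF K, of t j "j + 2"] by (auto simp: bump_slope_def indicator_def power_mult_distrib)
  have "zero_primitive h (bump_slope K j)"
    unfolding zero_primitive_def
  proof (intro conjI allI impI)
    show "integrable lborel (\<lambda>t. (bump_slope K j t)\<^sup>2)"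
      unfolding sq by (intro integrable_mult_right Bochner_Integration.integrable_add integrable_indicator_cell)
    fix t :: real assume t: "t \<notin> {0..1}"
    have "cell K k \<subseteq> {0..1}" if "k + 1 \<le> K" for k
    proof
      fix y assume "y \<in> cell K k"
      then have "real k / real K < y" "y \<le> (real k + 1) / real K" by (auto simp: cell_def)
      moreover have "(real k + 1) / real K \<le> 1" using that K by (simp add: field_simps)
      moreover have "0 \<le> real k / real K" by simp
      ultimately show "y \<in> {0..1}" unfolding atLeastAtMost_iff by linarith
    qed
    from this[of j] this[of "j + 2"] have "t \<notin> cell K j" "t \<notin> cell K (j + 2)" using t j by auto
    then show "bump_slope K j t = 0" by (simp add: bump_slope_def)
  qed (auto simp: h_def total)
  then obtain f where f: "fun_of f = h" "AE t in lborel. grad f t = bump_slope K j t"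
    by (rule zero_primitive_fun_of)
  have pos: "real k < real K * x \<and> real K * x \<le> real k + 1" if "x \<in> cell K k" for x k
    using that K by (auto simp: cell_def field_simps)
  have one: "h x = 1" if x: "x \<in> cell K (j + 1)" for x
  proof -
    have "indicator {..x} t * bump_slope K j t = real K * indicator (cell K j) t" for t
    proof -
      have "t \<le> x" if "t \<in> cell K j"
      proof -
        have "real K * t < real K * x" using pos[OF x] pos[OF that] by simp
        then show ?thesis using K by simp
      qed
      moreover have "\<not> t \<le> x" if "t \<in> cell K (j + 2)"
      proof -
        have "real K * x < real K * t" using pos[OF x] pos[OF that] by simp
        then show ?thesis using K by simp
      qed
      ultimately show ?thesis by (auto simp: bump_slope_def indicator_def)
    qed
    then show ?thesis using K by (simp add: h_def)
  qed
  have zero: "h x = 0" if x: "x \<in> cell K k" and k: "k < j \<or> j + 2 < k" for x k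
    using k
  proof
    assume "k < j"
    then have "indicator {..x} t * bump_slope K j t = 0" for t
    proof -
      have "\<not> t \<le> x" if "t \<in> cell K l" "j \<le> l" for l
      proof -
        have "real K * x < real K * t" using pos[OF x] pos[OF that(1)] that(2) \<open>k < j\<close> by linarith
        then show ?thesis using K by simp
      qed
      from this[of j] this[of "j + 2"] show ?thesis by (auto simp: bump_slope_def indicator_def)
    qed
    then show ?thesis unfolding h_def by (intro integral_eq_zero_AE AE_I2)
  next
    assume "j + 2 < k"
    then have "indicator {..x} t * bump_slope K j t = bump_slope K j t" for t
    proof -
      have "t \<le> x" if "t \<in> cell K l" "l \<le> j + 2" for l
      proof -
        have "real K * t < real K * x" using pos[OF x] pos[OF that(1)] that(2) \<open>j + 2 < k\<close> by linarith
        then show ?thesis using K by simp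
      qed
      from this[of j] this[of "j + 2"] show ?thesis by (auto simp: bump_slope_def indicator_def)
    qed
    then have "(\<lambda>t. indicator {..x} t * bump_slope K j t) = bump_slope K j" by (rule ext)
    then show ?thesis using total unfolding h_def by simp
  qed
  show ?thesis using f one zero by blast
qed

context dominated_measure
begin

text \<open>Each trapezoid has energy 2 K and those with indices at least 3 apart have disjoint
  supports. For a combination with coefficients \<open>a j\<close> the energy is 2 K times the sum
  of their squares, while the plateaus alone contribute at least \<open>\<delta>\<close> times that
  sum to the \<open>\<nu>\<close>-form; the ratio is \<open>\<delta> / (2 * real K)\<close>.\<close>

lemma eigenvalue_count_ge_charged_cells:
  assumes K: "K > 0" and \<delta>: "\<delta> > 0" and x: "2 * real K / \<delta> \<le> x"
    and G: "\<And>j. j \<in> G \<Longrightarrow> j + 3 \<le> K" "\<And>j. j \<in> G \<Longrightarrow> measure \<nu> (cell K (j + 1)) \<ge> \<delta>"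
      "\<And>i j. i \<in> G \<Longrightarrow> j \<in> G \<Longrightarrow> i < j \<Longrightarrow> i + 3 \<le> j"
  shows "card G \<le> eigenvalue_count \<nu> x"
proof -
  have fin: "finite G" using G(1) by (intro finite_subset[of G "{..K}"]) fastforce+
  have "\<forall>j\<in>G. \<exists>f. (AE t in lborel. grad f t = bump_slope K j t) \<and>
      (\<forall>x\<in>cell K (j + 1). fun_of f x = 1) \<and>
      (\<forall>k. k < j \<or> j + 2 < k \<longrightarrow> (\<forall>x\<in>cell K k. fun_of f x = 0))"
    using bump_exists G(1) by blast
  from bchoice[OF this] obtain \<phi> where "\<forall>j\<in>G. (AE t in lborel. grad (\<phi> j) t = bump_slope K j t) \<and>
      (\<forall>x\<in>cell K (j + 1). fun_of (\<phi> j) x = 1) \<and>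
      (\<forall>k. k < j \<or> j + 2 < k \<longrightarrow> (\<forall>x\<in>cell K k. fun_of (\<phi> j) x = 0))" ..
  then have \<phi>: "\<And>j. j \<in> G \<Longrightarrow> AE t in lborel. grad (\<phi> j) t = bump_slope K j t"
    "\<And>j x. j \<in> G \<Longrightarrow> x \<in> cell K (j + 1) \<Longrightarrow> fun_of (\<phi> j) x = 1"
    "\<And>j x k. j \<in> G \<Longrightarrow> x \<in> cell K k \<Longrightarrow> k < j \<or> j + 2 < k \<Longrightarrow> fun_of (\<phi> j) x = 0"
    by blast+
  have inner: "inner (\<phi> i) (\<phi> j) = (if i = j then 2 * real K else 0)" if ij: "i \<in> G" "j \<in> G" for i j
  proof -
    have "inner (\<phi> i) (\<phi> j) = (LINT t|lborel. bump_slope K i t * bump_slope K j t)"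
      by (rule inner_h10_AE[OF \<phi>(1)[OF ij(1)] \<phi>(1)[OF ij(2)]]) measurable
    also have "\<dots> = (if i = j then 2 * real K else 0)"
    proof (cases "i = j")
      case True
      have "bump_slope K j t * bump_slope K j t
          = (real K)\<^sup>2 * (indicator (cell K j) t + indicator (cell K (j + 2)) t)" for t
        using cell_unique[OF K, of t j "j + 2"]
        by (auto simp: bump_slope_def indicator_def power2_eq_square)
      then show ?thesis
        using True K
        by (simp add: Bochner_Integration.integral_add[OF integrable_indicator_cell integrable_indicator_cell]
            power2_eq_square)
    next
      case False
      then have "i + 3 \<le> j \<or> j + 3 \<le> i" using G(3)[of i j] G(3)[of j i] ij by linarith
      then have "bump_slope K i t * bump_slope K j t = 0" for t
        using cell_unique[OF K, of t i j] cell_unique[OF K, of t i "j + 2"]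
          cell_unique[OF K, of t "i + 2" j] cell_unique[OF K, of t "i + 2" "j + 2"]
        by (auto simp: bump_slope_def indicator_def)
      then have "(\<lambda>t. bump_slope K i t * bump_slope K j t) = (\<lambda>_. 0)" by (intro ext)
      then show ?thesis using False by simp
    qed
    finally show ?thesis .
  qed
  have inj: "inj_on \<phi> G"
  proof (rule inj_onI, rule ccontr)
    fix i j assume "i \<in> G" "j \<in> G" "\<phi> i = \<phi> j" "i \<noteq> j"
    then show False using inner[of i j] inner[of i i] K by simp
  qed
  have "pairwise orthogonal (\<phi> ` G)"
    using inner by (auto simp: pairwise_def orthogonal_def)
  moreover have "0 \<notin> \<phi> ` G"
  proof
    assume "0 \<in> \<phi> ` G"
    then obtain j where "j \<in> G" "\<phi> j = 0" by auto
    then show False using inner[of j j] K by simp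
  qed
  ultimately have indep: "independent (\<phi> ` G)" by (rule pairwise_orthogonal_independent)
  have le: "\<delta> / (2 * real K) * (norm v)\<^sup>2 \<le> prod_form v v" if "v \<in> span (\<phi> ` G)" for v
  proof -
    have "v \<in> range (\<lambda>u. \<Sum>w\<in>\<phi> ` G. u w *\<^sub>R w)"
      using that span_finite[of "\<phi> ` G"] fin by simp
    then obtain a' where "v = (\<Sum>w\<in>\<phi> ` G. a' w *\<^sub>R w)" by (rule rangeE)
    then have v: "v = (\<Sum>j\<in>G. a' (\<phi> j) *\<^sub>R \<phi> j)" by (simp add: sum.reindex[OF inj])
    define a where "a j = a' (\<phi> j)" for j
    have v: "v = (\<Sum>j\<in>G. a j *\<^sub>R \<phi> j)" using v by (simp add: a_def)
    have "inner (\<phi> i) v = 2 * real K * a i" if i: "i \<in> G" for i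
    proof -
      have "inner (\<phi> i) v = (\<Sum>j\<in>G. if j = i then 2 * real K * a i else 0)"
        unfolding v inner_sum_right by (intro sum.cong) (auto simp: inner[OF i])
      then show ?thesis using fin i by simp
    qed
    then have "inner v v = (\<Sum>j\<in>G. 2 * real K * (a j)\<^sup>2)"
      by (subst (1) v) (simp add: inner_sum_left power2_eq_square mult_ac)
    then have "\<delta> / (2 * real K) * (norm v)\<^sup>2 = (\<Sum>j\<in>G. (a j)\<^sup>2 * \<delta>)"
      using K by (simp add: power2_norm_eq_inner sum_distrib_left mult_ac)
    also have "\<dots> \<le> (\<Sum>j\<in>G. (a j)\<^sup>2 * measure \<nu> (cell K (j + 1)))"
      by (intro sum_mono mult_left_mono G(2)) auto
    also have "\<dots> = (LINT y|\<nu>. (\<Sum>j\<in>G. (a j)\<^sup>2 * indicator (cell K (j + 1)) y))"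
      by (subst Bochner_Integration.integral_sum) (auto simp: less_top[symmetric])
    also have "\<dots> \<le> prod_form v v"
      unfolding prod_form_def
    proof (intro integral_mono integrable_prod Bochner_Integration.integrable_sum)
      fix y
      show "(\<Sum>j\<in>G. (a j)\<^sup>2 * indicator (cell K (j + 1)) y) \<le> fun_of v y * fun_of v y"
      proof (cases "\<exists>i\<in>G. y \<in> cell K (i + 1)")
        case True
        then obtain i where i: "i \<in> G" "y \<in> cell K (i + 1)" by blast
        have "fun_of (\<phi> j) y = 0" if j: "j \<in> G" "j \<noteq> i" for j
        proof (rule \<phi>(3)[OF j(1) i(2)])
          show "i + 1 < j \<or> j + 2 < i + 1" using G(3)[of i j] G(3)[of j i] i j by linarith
        qed
        then have "fun_of v y = (\<Sum>j\<in>G. if j = i then a i else 0)"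
          unfolding v fun_of_sum using \<phi>(2)[OF i] by (intro sum.cong) auto
        then have "fun_of v y = a i" using fin i by simp
        moreover have "(\<Sum>j\<in>G. (a j)\<^sup>2 * indicator (cell K (j + 1)) y) = (\<Sum>j\<in>G. if j = i then (a i)\<^sup>2 else 0)"
        proof (rule sum.cong)
          fix j assume "j \<in> G"
          have "y \<notin> cell K (j + 1)" if "j \<noteq> i"
            using cell_unique[OF K i(2), of "j + 1"] that by auto
          then show "(a j)\<^sup>2 * indicator (cell K (j + 1)) y = (if j = i then (a i)\<^sup>2 else 0)"
            using i(2) by auto
        qed simp
        ultimately show ?thesis using fin i by (simp add: power2_eq_square)
      qed simp
    qed (auto simp: less_top[symmetric])
    finally show ?thesis .
  qed
  have "card (\<phi> ` G) \<le> eigenvalue_count \<nu> x"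
    using fin indep \<delta> K x by (intro eigenvalue_count_lower[OF _ indep _ _ le]) auto
  then show ?thesis by (simp add: card_image[OF inj])
qed

text \<open>Pigeonhole for \<open>\<rho>\<close>: a cell in the set carries at most 1/K, and all
  others together at most r/2. At least half of the mass r thus sits in the chosen cells, which
  requires at least r K / 2 of them.\<close>

lemma many_charged_cells:
  assumes K: "K > 0"
  defines "r \<equiv> measure \<rho> {0<..1}"
  shows "real (card {k. k < K \<and> r / (2 * real K) \<le> measure \<nu> (cell K k)}) \<ge> r / 2 * real K"
proof -
  define H where "H = {k. k < K \<and> r / (2 * real K) \<le> measure \<nu> (cell K k)}"
  have H: "finite H" "H \<subseteq> {..<K}" by (auto simp: H_def)
  have "r = (\<Sum>k<K. measure \<rho> (cell K k))"
    using sum_measure_equal_cells[OF \<rho>_finite sets_\<rho>, of "real K" K] K by (simp add: cell_def r_def)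
  also have "\<dots> \<le> (\<Sum>k<K. indicator H k * (1 / real K) + r / (2 * real K))"
  proof (rule sum_mono)
    fix k assume k: "k \<in> {..<K}"
    have r: "r \<ge> 0" by (simp add: r_def)
    show "measure \<rho> (cell K k) \<le> indicator H k * (1 / real K) + r / (2 * real K)"
    proof (cases "k \<in> H")
      case True
      have "measure \<rho> (cell K k) \<le> 1 / real K"
        using \<rho>_le_lborel[of "real k / real K" "(real k + 1) / real K"] K
        by (simp add: cell_def divide_right_mono diff_divide_distrib[symmetric])
      then show ?thesis using True r by (simp add: add_increasing2)
    next
      case False
      then have "measure \<nu> (cell K k) \<le> r / (2 * real K)" using k by (auto simp: H_def)
      then show ?thesis using False \<rho>_le_\<nu>[of "cell K k"] by simp
    qed
  qed
  also have "\<dots> = real (card H) / real K + r / 2"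
  proof -
    have "(\<Sum>k<K. indicator H k :: real) = (\<Sum>k\<in>H. 1)"
      by (rule sum.mono_neutral_cong_right) (use H in auto)
    then show ?thesis
      using K by (simp add: sum.distrib sum_divide_distrib[symmetric])
  qed
  finally have "r / 2 * real K \<le> real (card H)" using K by (simp add: field_simps)
  then show ?thesis by (simp add: H_def)
qed

text \<open>With \<open>\<delta> = r / (2 * real K)\<close> the threshold
  \<open>2 * real K / \<delta>\<close> becomes \<open>4 * (real K)\<^sup>2 / r\<close>. Sorting
  indices by residue modulo 3 produces the required gaps and costs the factor 3.\<close>

lemma eigenvalue_count_ge_linear:
  assumes K: "K > 0"
  defines "r \<equiv> measure \<rho> {0<..1}"
  assumes x: "4 * (real K)\<^sup>2 / r \<le> x"
  shows "(r / 2 * real K - 2) / 3 \<le> real (eigenvalue_count \<nu> x)"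
proof -
  have r: "r > 0" using \<rho>_pos by (simp add: r_def)
  define H where "H = {k. k < K \<and> r / (2 * real K) \<le> measure \<nu> (cell K k)}"
  \<comment> \<open>The first and last cells cannot carry a plateau, as the trapezoid needs a
    neighbouring cell inside [0,1] on each side. This is the 2 subtracted in the bound.\<close>
  define H' where "H' = H - {0, K - 1}"
  define G where "G s = {j. j + 1 \<in> H' \<and> j mod 3 = s}" for s :: nat
  have fin: "finite H" by (simp add: H_def)
  have "card (H - {0, K - 1}) \<ge> card H - card {0, K - 1}" by (rule diff_card_le_card_Diff) simp
  moreover have "card {0, K - 1} \<le> 2" by (simp add: card_insert_if)
  ultimately have "card H \<le> card H' + 2" unfolding H'_def by linarith
  then have H': "r / 2 * real K - 2 \<le> real (card H')"
    using many_charged_cells[OF K] unfolding H_def r_def by linarith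
  have fin': "finite H'" using fin by (simp add: H'_def)
  have finG: "finite (G s)" for s
    by (rule finite_subset[of _ "(\<lambda>k. k - 1) ` H'"]) (use fin' in \<open>force simp: G_def image_iff\<close>)+
  have "H' \<subseteq> Suc ` (G 0 \<union> G 1 \<union> G 2)"
  proof
    fix k assume k: "k \<in> H'"
    then have "k \<noteq> 0" by (auto simp: H'_def)
    then obtain j where j: "k = Suc j" by (cases k) auto
    have "j mod 3 < 3" by simp
    then have "j mod 3 = 0 \<or> j mod 3 = 1 \<or> j mod 3 = 2" by linarith
    then show "k \<in> Suc ` (G 0 \<union> G 1 \<union> G 2)" using k j by (auto simp: G_def)
  qed
  then have "card H' \<le> card (Suc ` (G 0 \<union> G 1 \<union> G 2))" using finG by (intro card_mono) auto
  also have "\<dots> \<le> card (G 0 \<union> G 1 \<union> G 2)" using finG by (intro card_image_le) auto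
  also have "\<dots> \<le> card (G 0) + card (G 1) + card (G 2)"
    using card_Un_le[of "G 0 \<union> G 1" "G 2"] card_Un_le[of "G 0" "G 1"] by linarith
  also have "\<dots> \<le> 3 * eigenvalue_count \<nu> x"
  proof -
    have "card (G s) \<le> eigenvalue_count \<nu> x" for s
    proof (rule eigenvalue_count_ge_charged_cells[OF K])
      show "r / (2 * real K) > 0" using r K by simp
      show "2 * real K / (r / (2 * real K)) \<le> x" using x by (simp add: power2_eq_square)
      show "j + 3 \<le> K" if "j \<in> G s" for j
        using that by (auto simp: G_def H'_def H_def)
      show "r / (2 * real K) \<le> measure \<nu> (cell K (j + 1))" if "j \<in> G s" for j
        using that by (auto simp: G_def H'_def H_def)
      show "i + 3 \<le> j" if "i \<in> G s" "j \<in> G s" "i < j" for i j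
      proof -
        have "i mod 3 = j mod 3" using that by (simp add: G_def)
        then show ?thesis using \<open>i < j\<close> by presburger
      qed
    qed
    from this[of 0] this[of 1] this[of 2] show ?thesis by linarith
  qed
  finally have "real (card H') \<le> real (3 * eigenvalue_count \<nu> x)" by (simp only: of_nat_le_iff)
  then show ?thesis using H' by simp
qed

lemma eigenvalue_count_ge_sqrt:
  obtains a b where "a > 0" "\<And>x. x \<ge> b \<Longrightarrow> a * sqrt x \<le> real (eigenvalue_count \<nu> x)"
proof -
  define r where "r = measure \<rho> {0<..1}"
  have r: "r > 0" using \<rho>_pos by (simp add: r_def)
  have lower: "(r / 2 * (sqrt (r * x) / 2 - 1) - 2) / 3 \<le> real (eigenvalue_count \<nu> x)"
    if x: "sqrt (r * x) \<ge> 2" for x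
  proof -
    \<comment> \<open>The largest integer with \<open>4 * (real K)\<^sup>2 / r \<le> x\<close>; the
      assumption on \<open>x\<close> makes it positive.\<close>
    define K where "K = nat \<lfloor>sqrt (r * x) / 2\<rfloor>"
    have K: "real K \<le> sqrt (r * x) / 2" "sqrt (r * x) / 2 - 1 \<le> real K" "K > 0"
      using x unfolding K_def by linarith+
    have "r * x \<ge> 0" using x by (smt (verit) real_sqrt_le_0_iff)
    have "(2 * real K)\<^sup>2 \<le> (sqrt (r * x))\<^sup>2" using K by (intro power_mono) auto
    then have "4 * (real K)\<^sup>2 \<le> r * x" using \<open>r * x \<ge> 0\<close> by (simp add: power_mult_distrib)
    then have "4 * (real K)\<^sup>2 / r \<le> x" using r by (simp add: field_simps)
    then have "(r / 2 * real K - 2) / 3 \<le> real (eigenvalue_count \<nu> x)"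
      using eigenvalue_count_ge_linear[OF K(3)] unfolding r_def by blast
    moreover have "(r / 2 * (sqrt (r * x) / 2 - 1) - 2) / 3 \<le> (r / 2 * real K - 2) / 3"
      using K r by (intro divide_right_mono diff_right_mono mult_left_mono) auto
    ultimately show ?thesis by (rule order_trans[rotated])
  qed
  have "\<forall>\<^sub>F x in at_top. sqrt (r * x) \<ge> 2 \<and>
      r * sqrt r / 24 * sqrt x \<le> (r / 2 * (sqrt (r * x) / 2 - 1) - 2) / 3"
  proof -
    \<comment> \<open>The leading term of the lower bound is
      \<open>r * sqrt r / 12 * sqrt x\<close>. Half of it absorbs the constant
      \<open>r / 6 + 2 / 3\<close> once \<open>sqrt x \<ge> C\<close>, which leaves the factor
      1/24.\<close>
    define C where "C = 24 * (r / 6 + 2 / 3) / (r * sqrt r)"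
    have "\<forall>\<^sub>F x in at_top. C \<le> sqrt x" by real_asymp
    then have "\<forall>\<^sub>F x in at_top. r * sqrt r / 24 * sqrt x \<le> (r / 2 * (sqrt (r * x) / 2 - 1) - 2) / 3"
    proof eventually_elim
      case (elim x)
      then have "r / 6 + 2 / 3 \<le> r * sqrt r / 24 * sqrt x"
        using r by (simp add: C_def field_simps)
      moreover have "(r / 2 * (sqrt (r * x) / 2 - 1) - 2) / 3
          = 2 * (r * sqrt r / 24 * sqrt x) - (r / 6 + 2 / 3)"
        by (simp add: real_sqrt_mult field_simps)
      ultimately show ?case by linarith
    qed
    moreover have "\<forall>\<^sub>F x in at_top. sqrt (r * x) \<ge> 2" using r by real_asymp
    ultimately show ?thesis by eventually_elim blast
  qed
  then obtain b where b: "\<And>x. x \<ge> b \<Longrightarrow> sqrt (r * x) \<ge> 2 \<and>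
      r * sqrt r / 24 * sqrt x \<le> (r / 2 * (sqrt (r * x) / 2 - 1) - 2) / 3"
    unfolding eventually_at_top_linorder by blast
  show ?thesis
  proof (rule that)
    show "r * sqrt r / 24 > 0" using r by simp
    show "r * sqrt r / 24 * sqrt x \<le> real (eigenvalue_count \<nu> x)" if "x \<ge> b" for x
      using b[OF that] lower[of x] by (auto intro: order_trans)
  qed
qed

text \<open>The count lies between constant multiples of \<open>sqrt x\<close>, up to an added 1,
  and the constants disappear in the quotient of logarithms. The positive lower bound also keeps the
  logarithm of the count away from \<open>ln 0\<close>.\<close>

lemma ln_eigenvalue_count_tendsto:
  "((\<lambda>x. ln (real (eigenvalue_count \<nu> x)) / ln x) \<longlongrightarrow> 1 / 2) at_top"
proof -
  obtain a b where a: "a > 0" and lower: "\<And>x. x \<ge> b \<Longrightarrow> a * sqrt x \<le> real (eigenvalue_count \<nu> x)"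
    using eigenvalue_count_ge_sqrt by blast
  define c where "c = 1 + mass"
  have c: "c > 0" using mass_nonneg by (simp add: c_def)
  have ev: "\<forall>\<^sub>F x in at_top. x \<ge> b \<and> x > 1"
    by (intro eventually_conj eventually_ge_at_top eventually_gt_at_top)
  show ?thesis
  proof (rule real_tendsto_sandwich)
    show "\<forall>\<^sub>F x in at_top. ln (a * sqrt x) / ln x \<le> ln (real (eigenvalue_count \<nu> x)) / ln x"
      using ev
    proof eventually_elim
      case (elim x)
      then have "0 < a * sqrt x" using a by simp
      then show ?case using lower[of x] elim by (intro divide_right_mono ln_mono) auto
    qed
    show "\<forall>\<^sub>F x in at_top. ln (real (eigenvalue_count \<nu> x)) / ln x \<le> ln (c * sqrt x + 1) / ln x"
      using ev
    proof eventually_elim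
      case (elim x)
      then have "0 < a * sqrt x" using a by simp
      then show ?case
        using lower[of x] elim eigenvalue_count_upper(1)[of x]
        by (intro divide_right_mono ln_mono) (auto simp: c_def)
    qed
    show "((\<lambda>x. ln (a * sqrt x) / ln x) \<longlongrightarrow> 1 / 2) at_top" using a by real_asymp
    show "((\<lambda>x. ln (c * sqrt x + 1) / ln x) \<longlongrightarrow> 1 / 2) at_top" using c by real_asymp
  qed
qed

lemma spectral_dim_eq:
  "lower_spectral_dim \<nu> = ereal (1 / 2)" "upper_spectral_dim \<nu> = ereal (1 / 2)"
  using ln_eigenvalue_count_tendsto unfolding lower_spectral_dim_def upper_spectral_dim_def
  by (auto intro!: lim_imp_Liminf lim_imp_Limsup)

end

theorem corollary1p3:
  fixes \<nu> \<nu>a \<nu>s :: "real measure"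
  assumes "finite_borel_measure_01 \<nu>"
    and "lebesgue_decomposition \<nu> \<nu>a \<nu>s"
    and "emeasure \<nu>a UNIV \<noteq> 0"
  shows "(\<forall>q\<in>{0..1}. (\<lambda>n. beta_n \<nu> n q) \<longlonglongrightarrow> 1 - q \<and> beta \<nu> q = ereal (1 - q))
    \<and> Lq_regular \<nu>
    \<and> lower_spectral_dim \<nu> = ereal (1 / 2)
    \<and> upper_spectral_dim \<nu> = ereal (1 / 2)"
proof -
  obtain \<rho> where "dominated_measure \<nu> \<rho>" using dominated_measure_exists[OF assms] ..
  then interpret dominated_measure \<nu> \<rho> .
  have "\<forall>q\<in>{0..1}. (\<lambda>n. beta_n \<nu> n q) \<longlonglongrightarrow> 1 - q \<and> beta \<nu> q = ereal (1 - q)"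
    using beta_n_tendsto beta_eq(1) by simp
  then show ?thesis
    using Lq_regular spectral_dim_eq by blast
qed

end
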